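(* A finite group is evolving if and only if it is prime-intense.
   Context: A group $G$ is called evolving if it is finite and if, for every prime number $p$ and for every $p$-subgroup $I$ of $G$, there exists a subgroup $J$ of $G$ that contains $I$ and such that $|G:J|$ is a power of $p$ and $|J:I|$ is coprime to $p$. A finite group $G$ is called prime-intense if it possesses a collection $(S_p)_{p\mid |G|}\in\prod_{p\mid |G|}\mathrm{Syl}_p(G)$ of Sylow subgroups (one for each prime divisor $p$ of $|G|$) with the property that, for all primes $p>q$ dividing $|G|$, one has $S_q\subseteq N_G(S_p)$ and, for each subgroup $H$ of $S_p$ and each $x\in S_q$, the subgroups $xHx^{-1}$ and $H$ are conjugate by an element of $S_p$. *)

theory Defs
  imports "HOL-Algebra.Sylow" "HOL-Algebra.Group_Action" "HOL-Algebra.Zassenhaus"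
begin

definition subgroup_index :: "('a, 'b) monoid_scheme \<Rightarrow> 'a set \<Rightarrow> nat"
  where "subgroup_index G H = card (rcosets\<^bsub>G\<^esub> H)"

definition conj_by :: "('a, 'b) monoid_scheme \<Rightarrow> 'a \<Rightarrow> 'a set \<Rightarrow> 'a set"
  where "conj_by G x H = x <#\<^bsub>G\<^esub> H #>\<^bsub>G\<^esub> (inv\<^bsub>G\<^esub> x)"

text \<open>The exponent may be zero: the trivial subgroup is a p-subgroup for every prime p.\<close>

definition p_subgroup :: "nat \<Rightarrow> 'a set \<Rightarrow> ('a, 'b) monoid_scheme \<Rightarrow> bool"
  where "p_subgroup p I G \<longleftrightarrow> subgroup I G \<and> (\<exists>n. card I = p ^ n)"

definition Syl :: "nat \<Rightarrow> ('a, 'b) monoid_scheme \<Rightarrow> 'a set set"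
  where "Syl p G = {S. subgroup S G \<and> card S = p ^ multiplicity p (order G)}"

definition evolving :: "('a, 'b) monoid_scheme \<Rightarrow> bool"
  where "evolving G \<longleftrightarrow>
    group G \<and> finite (carrier G) \<and>
    (\<forall>p I. prime p \<longrightarrow> p_subgroup p I G \<longrightarrow>
      (\<exists>J. subgroup J G \<and> I \<subseteq> J \<and>
        (\<exists>n. subgroup_index G J = p ^ n) \<and>
        coprime (subgroup_index (G\<lparr>carrier := J\<rparr>) I) p))"

text \<open>A collection of Sylow subgroups indexed by the prime divisors of the order is a function on
  the naturals, whose values at all other indices are irrelevant.\<close>

definition prime_intense :: "('a, 'b) monoid_scheme \<Rightarrow> bool"
  where "prime_intense G \<longleftrightarrow>
    group G \<and> finite (carrier G) \<and>
    (\<exists>S :: nat \<Rightarrow> 'a set.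
      (\<forall>p. prime p \<longrightarrow> p dvd order G \<longrightarrow> S p \<in> Syl p G) \<and>
      (\<forall>p q. prime p \<longrightarrow> prime q \<longrightarrow> p dvd order G \<longrightarrow> q dvd order G \<longrightarrow> q < p \<longrightarrow>
        S q \<subseteq> normalizer G (S p) \<and>
        (\<forall>H x. subgroup H G \<longrightarrow> H \<subseteq> S p \<longrightarrow> x \<in> S q \<longrightarrow>
          (\<exists>y \<in> S p. conj_by G x H = conj_by G y H))))"

end

theory Submission
  imports Defs
begin

text \<open>
  Evolving implies prime-intense. If \<open>p\<close> is the largest prime divisor of \<open>|G|\<close> and \<open>q\<close> a smaller one, the
  evolving property for a subgroup of index \<open>q\<close> in a Sylow \<open>q\<close>-subgroup gives a subgroup \<open>J\<close> of \<open>G\<close> of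
  index \<open>q\<close>. As \<open>q < p\<close>, every \<open>p\<close>-subgroup lies in \<open>J\<close>, hence in its normal core. Normal subgroups
  of evolving groups are evolving, so by induction the Sylow \<open>p\<close>-subgroup \<open>P\<close> is normal in the core
  and therefore in \<open>G\<close>. For \<open>H \<le> P\<close> and the corresponding \<open>J \<ge> H\<close> we have \<open>H = J \<inter> P \<lhd> J\<close> and
  \<open>G = PJ\<close>, so every \<open>G\<close>-conjugate of \<open>H\<close> is a \<open>P\<close>-conjugate. The \<open>p\<close>-complement obtained from the trivial
  \<open>p\<close>-subgroup is again evolving, which allows induction.

  Prime-intense implies evolving. Replace \<open>I\<close> by a conjugate inside \<open>S\<^sub>p\<close>. The \<open>S\<^sub>p\<close>-conjugates of \<open>I\<close> are
  permuted by each \<open>S\<^sub>q\<close> with \<open>q < p\<close>, and a fixed point argument, repeated for the primes \<open>q < p\<close> in descending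
  order, yields a conjugate \<open>H\<close> normalized by all these \<open>S\<^sub>q\<close>. The product of \<open>H\<close> and all \<open>S\<^sub>q\<close> with
  \<open>q \<noteq> p\<close> is then the required subgroup.
\<close>

lemma multiplicity_power_times:
  fixes p c :: nat
  assumes "prime p" "\<not> p dvd c"
  shows "multiplicity p (p ^ n * c) = n"
proof -
  have "c \<noteq> 0" using assms(2) by (metis dvd_0_right)
  then show ?thesis
    using assms by (simp add: prime_elem_multiplicity_mult_distrib not_dvd_imp_multiplicity_0)
qed

context group
begin

subsection \<open>Conjugation of subsets\<close>

lemma conj_by_image: "conj_by G x H = (\<lambda>h. x \<otimes> h \<otimes> inv x) ` H"
  by (auto simp: conj_by_def l_coset_def r_coset_def)

lemma conj_by_subset:
  assumes "x \<in> carrier G" "H \<subseteq> carrier G"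
  shows "conj_by G x H \<subseteq> carrier G"
  using assms by (auto simp: conj_by_image)

lemma conj_by_one:
  assumes "H \<subseteq> carrier G"
  shows "conj_by G \<one> H = H"
proof -
  have "(\<lambda>h. \<one> \<otimes> h \<otimes> inv \<one>) ` H = (\<lambda>h. h) ` H"
    by (rule image_cong) (use assms in auto)
  then show ?thesis by (simp add: conj_by_image)
qed

lemma conj_by_mult:
  assumes "x \<in> carrier G" "y \<in> carrier G" "H \<subseteq> carrier G"
  shows "conj_by G x (conj_by G y H) = conj_by G (x \<otimes> y) H"
proof -
  have "x \<otimes> (y \<otimes> h \<otimes> inv y) \<otimes> inv x = x \<otimes> y \<otimes> h \<otimes> inv (x \<otimes> y)" if "h \<in> H" for h
    using assms that by (auto simp: inv_mult_group m_assoc subset_iff)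
  then show ?thesis
    unfolding conj_by_image image_image by (auto intro!: image_cong)
qed

lemma conj_by_inv_cancel:
  assumes "x \<in> carrier G" "H \<subseteq> carrier G"
  shows "conj_by G (inv x) (conj_by G x H) = H" "conj_by G x (conj_by G (inv x) H) = H"
  using assms by (simp_all add: conj_by_mult conj_by_one)

lemma card_conj_by:
  assumes "x \<in> carrier G" "H \<subseteq> carrier G"
  shows "card (conj_by G x H) = card H"
  unfolding conj_by_image by (rule card_image) (use assms in \<open>auto intro!: inj_onI simp: subset_iff\<close>)

lemma conj_by_mono: "H \<subseteq> K \<Longrightarrow> conj_by G x H \<subseteq> conj_by G x K"
  by (auto simp: conj_by_image)

lemma subgroup_conj_by:
  assumes x: "x \<in> carrier G" and H: "subgroup H G"
  shows "subgroup (conj_by G x H) G"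
proof (rule subgroupI)
  have sub: "H \<subseteq> carrier G" by (rule subgroup.subset[OF H])
  show "conj_by G x H \<subseteq> carrier G" by (rule conj_by_subset[OF x sub])
  show "conj_by G x H \<noteq> {}" using subgroup.one_closed[OF H] by (auto simp: conj_by_image)
  fix a assume "a \<in> conj_by G x H"
  then obtain h where h: "h \<in> H" "a = x \<otimes> h \<otimes> inv x" by (auto simp: conj_by_image)
  have "inv a = x \<otimes> inv h \<otimes> inv x"
    using h x sub by (auto simp: inv_mult_group m_assoc subset_iff)
  then show "inv a \<in> conj_by G x H"
    using subgroup.m_inv_closed[OF H h(1)] by (auto simp: conj_by_image)
  fix b assume "b \<in> conj_by G x H"
  then obtain k where k: "k \<in> H" "b = x \<otimes> k \<otimes> inv x" by (auto simp: conj_by_image)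
  have "inv x \<otimes> (x \<otimes> (k \<otimes> inv x)) = k \<otimes> inv x"
    using k x sub by (simp add: m_assoc[symmetric] subset_iff)
  then have "a \<otimes> b = x \<otimes> (h \<otimes> k) \<otimes> inv x"
    using h k x sub by (simp add: m_assoc subset_iff)
  then show "a \<otimes> b \<in> conj_by G x H"
    using subgroup.m_closed[OF H h(1) k(1)] by (auto simp: conj_by_image)
qed

lemma conj_by_self:
  assumes H: "subgroup H G" and x: "x \<in> H"
  shows "conj_by G x H = H"
proof -
  have sub: "H \<subseteq> carrier G" and xG: "x \<in> carrier G"
    using subgroup.subset[OF H] x by auto
  have cl: "conj_by G y H \<subseteq> H" if "y \<in> H" for y
    using that H by (auto simp: conj_by_image subgroup.m_closed subgroup.m_inv_closed)
  \<comment> \<open>Elementwise reasoning gives one inclusion; used for \<open>inv x\<close> and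
    conjugated back by \<open>x\<close>, it gives the other.\<close>
  have "H = conj_by G x (conj_by G (inv x) H)" using xG sub by (simp add: conj_by_inv_cancel)
  also have "\<dots> \<subseteq> conj_by G x H"
    by (intro conj_by_mono cl) (rule subgroup.m_inv_closed[OF H x])
  finally show ?thesis using cl[OF x] by blast
qed

text \<open>As \<open>x\<close> lies in \<open>U\<close>, its inverse in \<open>U\<close> is its
  inverse in \<open>G\<close>. This carries results obtained inside a subgroup, by Sylow's theorem
  or by induction, back to the whole group.\<close>

lemma conj_by_update:
  assumes "subgroup U G" "x \<in> U"
  shows "conj_by (G\<lparr>carrier := U\<rparr>) x H = conj_by G x H"
  using assms by (simp add: conj_by_def)

lemma normalizer_iff:
  assumes "H \<subseteq> carrier G"
  shows "x \<in> normalizer G H \<longleftrightarrow> x \<in> carrier G \<and> conj_by G x H = H"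
  using assms by (simp add: normalizer_def stabilizer_def conj_by_def)

lemma normal_conj_by:
  assumes "N \<lhd> G" "x \<in> carrier G"
  shows "conj_by G x N = N"
proof -
  interpret normal N G by (rule assms)
  have cl: "conj_by G y N \<subseteq> N" if "y \<in> carrier G" for y
    using that by (auto simp: conj_by_image inv_op_closed2)
  have "N = conj_by G x (conj_by G (inv x) N)" using assms(2) subset by (simp add: conj_by_inv_cancel)
  also have "\<dots> \<subseteq> conj_by G x N"
    by (intro conj_by_mono cl inv_closed assms(2))
  finally show ?thesis using cl[OF assms(2)] by blast
qed

lemma normal_if_conj_by:
  assumes "subgroup N G" "\<And>x. x \<in> carrier G \<Longrightarrow> conj_by G x N = N"
  shows "N \<lhd> G"
  using assms by (intro normal_invI) (auto simp: conj_by_image)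

lemma conj_by_set_mult:
  assumes "x \<in> carrier G" "H \<subseteq> carrier G" "K \<subseteq> carrier G"
  shows "conj_by G x (H <#> K) = conj_by G x H <#> conj_by G x K"
proof -
  have "x \<otimes> (h \<otimes> k) \<otimes> inv x = (x \<otimes> h \<otimes> inv x) \<otimes> (x \<otimes> k \<otimes> inv x)" if "h \<in> H" "k \<in> K" for h k
  proof -
    have hk: "h \<in> carrier G" "k \<in> carrier G" using that assms by auto
    have "inv x \<otimes> (x \<otimes> (k \<otimes> inv x)) = k \<otimes> inv x"
      using hk assms(1) by (simp add: m_assoc[symmetric])
    then show ?thesis using hk assms(1) by (simp add: m_assoc)
  qed
  note e = this
  have "conj_by G x (H <#> K) = (\<lambda>(h, k). x \<otimes> (h \<otimes> k) \<otimes> inv x) ` (H \<times> K)"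
    unfolding conj_by_image set_mult_def by force
  also have "\<dots> = (\<lambda>(h, k). (x \<otimes> h \<otimes> inv x) \<otimes> (x \<otimes> k \<otimes> inv x)) ` (H \<times> K)"
    by (rule image_cong) (use e in auto)
  also have "\<dots> = conj_by G x H <#> conj_by G x K"
    unfolding conj_by_image set_mult_def by force
  finally show ?thesis .
qed

subsection \<open>Products of subgroups\<close>

text \<open>Only normalization of \<open>K\<close> by \<open>H\<close> is assumed, because the later
  factors are Sylow subgroups that are rarely normal in \<open>G\<close>. Elements of
  \<open>K\<close> are moved past elements of \<open>H\<close> by conjugating them.\<close>

lemma subgroup_set_mult:
  assumes H: "subgroup H G" and K: "subgroup K G"
    and norm: "\<And>h. h \<in> H \<Longrightarrow> conj_by G h K = K"
  shows "subgroup (H <#> K) G"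
proof -
  have sub: "H \<subseteq> carrier G" "K \<subseteq> carrier G" using H K by (auto dest: subgroup.subset)
  have inn: "h \<otimes> k \<otimes> inv h \<in> K" if "h \<in> H" "k \<in> K" for h k
    using norm[OF that(1)] that(2) by (auto simp: conj_by_image)
  show ?thesis
  proof (rule subgroupI)
    show "H <#> K \<subseteq> carrier G" by (rule setmult_subset_G[OF sub])
    show "H <#> K \<noteq> {}"
      using subgroup.one_closed[OF H] subgroup.one_closed[OF K] by (auto simp: set_mult_def)
    fix a assume "a \<in> H <#> K"
    then obtain h k where a: "h \<in> H" "k \<in> K" "a = h \<otimes> k" by (auto simp: set_mult_def)
    note hk = subgroup.m_inv_closed[OF H a(1)] subgroup.m_inv_closed[OF K a(2)]
    have c: "h \<in> carrier G" "k \<in> carrier G" using a sub by auto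
    have "inv a = inv h \<otimes> (h \<otimes> inv k \<otimes> inv h)"
      using c a(3) by (simp add: inv_mult_group m_assoc[symmetric])
    then show "inv a \<in> H <#> K"
      using inn[OF a(1) hk(2)] hk(1) by (auto simp: set_mult_def)
    fix b assume "b \<in> H <#> K"
    then obtain h' k' where b: "h' \<in> H" "k' \<in> K" "b = h' \<otimes> k'" by (auto simp: set_mult_def)
    have c': "h' \<in> carrier G" "k' \<in> carrier G" using b sub by auto
    have i: "inv h' \<otimes> k \<otimes> h' \<in> K"
      using inn[OF subgroup.m_inv_closed[OF H b(1)] a(2)] c' by simp
    have "h' \<otimes> (inv h' \<otimes> (k \<otimes> (h' \<otimes> k'))) = k \<otimes> (h' \<otimes> k')"
      using c c' by (simp add: m_assoc[symmetric])
    then have "a \<otimes> b = (h \<otimes> h') \<otimes> ((inv h' \<otimes> k \<otimes> h') \<otimes> k')"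
      using c c' a(3) b(3) by (simp add: m_assoc)
    then show "a \<otimes> b \<in> H <#> K"
      using subgroup.m_closed[OF H a(1) b(1)] subgroup.m_closed[OF K i b(2)]
      by (auto simp: set_mult_def)
  qed
qed

lemma set_mult_supset:
  assumes H: "subgroup H G" and K: "subgroup K G"
  shows "H \<subseteq> H <#> K" "K \<subseteq> H <#> K"
proof -
  have sub: "H \<subseteq> carrier G" "K \<subseteq> carrier G" using H K by (auto dest: subgroup.subset)
  show "H \<subseteq> H <#> K"
  proof
    fix h assume "h \<in> H"
    then have "h = h \<otimes> \<one>" using sub by auto
    then show "h \<in> H <#> K"
      using \<open>h \<in> H\<close> subgroup.one_closed[OF K] unfolding set_mult_def by blast
  qed
  show "K \<subseteq> H <#> K"
  proof
    fix k assume "k \<in> K"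
    then have "k = \<one> \<otimes> k" using sub by auto
    then show "k \<in> H <#> K"
      using \<open>k \<in> K\<close> subgroup.one_closed[OF H] unfolding set_mult_def by blast
  qed
qed

text \<open>The product set may fail to be a subgroup, so cosets are avoided: one factorization
  \<open>f z\<close> is chosen for each product \<open>z\<close>, and every other factorization of
  \<open>z\<close> differs from it by a unique \<open>d\<close> in
  \<open>H \<inter> K\<close>.\<close>

lemma card_set_mult:
  assumes H: "subgroup H G" and K: "subgroup K G"
  shows "card (H <#> K) * card (H \<inter> K) = card H * card K"
proof -
  have sub: "H \<subseteq> carrier G" "K \<subseteq> carrier G" using H K by (auto dest: subgroup.subset)
  have "\<forall>z \<in> H <#> K. \<exists>w. fst w \<in> H \<and> snd w \<in> K \<and> z = fst w \<otimes> snd w"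
    by (auto simp: set_mult_def)
  then obtain f where f: "\<And>z. z \<in> H <#> K \<Longrightarrow> fst (f z) \<in> H \<and> snd (f z) \<in> K \<and> z = fst (f z) \<otimes> snd (f z)"
    by metis
  let ?F = "\<lambda>(z, d). (fst (f z) \<otimes> d, inv d \<otimes> snd (f z))"
  have "bij_betw ?F ((H <#> K) \<times> (H \<inter> K)) (H \<times> K)"
  proof (rule bij_betw_imageI)
    show "inj_on ?F ((H <#> K) \<times> (H \<inter> K))"
    proof (rule inj_onI, clarify)
      fix z d z' d'
      assume *: "z \<in> H <#> K" "z' \<in> H <#> K" "d \<in> H" "d \<in> K" "d' \<in> H" "d' \<in> K"
        "fst (f z) \<otimes> d = fst (f z') \<otimes> d'" "inv d \<otimes> snd (f z) = inv d' \<otimes> snd (f z')"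
      have c: "fst (f z) \<in> carrier G" "snd (f z) \<in> carrier G" "fst (f z') \<in> carrier G"
        "snd (f z') \<in> carrier G" "d \<in> carrier G" "d' \<in> carrier G"
        using f[OF *(1)] f[OF *(2)] * sub by auto
      have "z = (fst (f z) \<otimes> d) \<otimes> (inv d \<otimes> snd (f z))"
        using f[OF *(1)] c by (metis inv_closed l_one m_assoc m_closed r_inv)
      also have "\<dots> = (fst (f z') \<otimes> d') \<otimes> (inv d' \<otimes> snd (f z'))" by (simp only: *)
      also have "\<dots> = z'"
        using f[OF *(2)] c by (metis inv_closed l_one m_assoc m_closed r_inv)
      finally have zz: "z = z'" .
      then have "d = d'" using *(7) c by simp
      then show "z = z' \<and> d = d'" using zz by simp
    qed
    show "?F ` ((H <#> K) \<times> (H \<inter> K)) = H \<times> K"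
    proof (intro equalityI subsetI)
      fix w assume "w \<in> ?F ` ((H <#> K) \<times> (H \<inter> K))"
      then show "w \<in> H \<times> K"
        using f H K by (auto intro!: subgroup.m_closed subgroup.m_inv_closed)
    next
      fix w assume "w \<in> H \<times> K"
      then obtain h k where w: "w = (h, k)" "h \<in> H" "k \<in> K" by auto
      define z where "z = h \<otimes> k"
      have z: "z \<in> H <#> K" using w by (auto simp: z_def set_mult_def)
      let ?h = "fst (f z)" and ?k = "snd (f z)"
      have fz: "?h \<in> H" "?k \<in> K" "h \<otimes> k = ?h \<otimes> ?k" using f[OF z] by (auto simp: z_def)
      have c: "h \<in> carrier G" "k \<in> carrier G" "?h \<in> carrier G" "?k \<in> carrier G"
        using w fz sub by auto
      \<comment> \<open>This \<open>d\<close> compares the given factorization of \<open>z\<close>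
        with the chosen one. Writing it once through \<open>H\<close> and once through
        \<open>K\<close> places it in the intersection.\<close>
      define d where "d = inv ?h \<otimes> h"
      have h: "h = ?h \<otimes> d" using c by (simp add: d_def m_assoc[symmetric])
      have dk: "d = ?k \<otimes> inv k"
      proof -
        have "d \<otimes> k = ?k" using fz(3) c by (simp add: d_def m_assoc) (simp add: m_assoc[symmetric])
        then show ?thesis using c by (simp add: d_def inv_solve_right)
      qed
      then have k: "k = inv d \<otimes> ?k" using c by (simp add: inv_mult_group m_assoc)
      have "d \<in> H" unfolding d_def using w fz H by (simp add: subgroup.m_closed subgroup.m_inv_closed)
      moreover have "d \<in> K" unfolding dk using w fz K by (simp add: subgroup.m_closed subgroup.m_inv_closed)
      ultimately have "(z, d) \<in> (H <#> K) \<times> (H \<inter> K)" using z by simp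
      moreover have "?F (z, d) = w" using h k w by simp
      ultimately show "w \<in> ?F ` ((H <#> K) \<times> (H \<inter> K))" by (metis (no_types, lifting) image_eqI)
    qed
  qed
  from bij_betw_same_card[OF this] show ?thesis by (simp add: card_cartesian_product)
qed

lemma card_subgroup_dvd:
  assumes H: "subgroup H G" and K: "subgroup K G" and "H \<subseteq> K"
  shows "card H dvd card K"
proof -
  interpret K: group "G\<lparr>carrier := K\<rparr>" by (rule subgroup_imp_group[OF K])
  have "card K = card (rcosets\<^bsub>G\<lparr>carrier := K\<rparr>\<^esub> H) * card H"
    using K.lagrange[OF subgroup_incl[OF H K \<open>H \<subseteq> K\<close>]] by (simp add: order_def)
  then show ?thesis by simp
qed

lemma card_subgroup_dvd_order:
  assumes "subgroup H G"
  shows "card H dvd order G"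
  using card_subgroup_dvd[OF assms subgroup_self subgroup.subset[OF assms]] by (simp add: order_def)

subsection \<open>Fixed points and Sylow subgroups\<close>

lemma subgroup_conj_stabilizer:
  assumes R: "subgroup R G" and H: "H \<subseteq> carrier G"
  shows "subgroup {x \<in> R. conj_by G x H = H} G"
proof -
  have "{x \<in> R. conj_by G x H = H} = R \<inter> normalizer G H"
    using subgroup.subset[OF R] by (auto simp: normalizer_iff[OF H])
  then show ?thesis
    using subgroups_Inter_pair[OF R normalizer_imp_subgroup[OF H]] by simp
qed

lemma card_conj_orbit:
  assumes R: "subgroup R G" and H: "H \<subseteq> carrier G"
  shows "card ((\<lambda>x. conj_by G x H) ` R) * card {x \<in> R. conj_by G x H = H} = card R"
proof -
  let ?\<phi> = "\<lambda>g. \<lambda>H \<in> {H. H \<subseteq> carrier G}. g <# H #> (inv g)"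
  interpret R: group_action "G\<lparr>carrier := R\<rparr>" "{H. H \<subseteq> carrier G}" ?\<phi>
    by (rule group_action.induced_action[OF action_by_conjugation_on_power_set R])
  have "orbit (G\<lparr>carrier := R\<rparr>) ?\<phi> H = (\<lambda>x. conj_by G x H) ` R"
    "stabilizer (G\<lparr>carrier := R\<rparr>) ?\<phi> H = {x \<in> R. conj_by G x H = H}"
    using H by (auto simp: orbit_def stabilizer_def conj_by_def)
  then show ?thesis
    using R.orbit_stabilizer_theorem[of H] H by (simp add: order_def)
qed

text \<open>Orbits of a \<open>q\<close>-group have \<open>q\<close>-power length. Without a fixed
  point every orbit length, and therefore \<open>card W\<close>, would be divisible by
  \<open>q\<close>.\<close>

lemma conj_fixed_point:
  assumes Q: "subgroup Q G" and q: "prime (q::nat)" and cQ: "card Q = q ^ n"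
    and fin: "finite W" and W: "\<And>H. H \<in> W \<Longrightarrow> H \<subseteq> carrier G"
    and act: "\<And>H x. H \<in> W \<Longrightarrow> x \<in> Q \<Longrightarrow> conj_by G x H \<in> W"
    and nd: "\<not> q dvd card W"
  shows "\<exists>H \<in> W. \<forall>x \<in> Q. conj_by G x H = H"
proof (rule ccontr)
  assume no: "\<not> ?thesis"
  define r where "r = {(H, K). H \<in> W \<and> K \<in> W \<and> (\<exists>x \<in> Q. K = conj_by G x H)}"
  have QG: "x \<in> carrier G" if "x \<in> Q" for x using that subgroup.subset[OF Q] by auto
  have eq: "equiv W r"
  proof (rule equivI)
    show "r \<subseteq> W \<times> W" by (auto simp: r_def)
    show "refl_on W r"
    proof (rule refl_onI)
      fix H assume "H \<in> W"
      then have "H = conj_by G \<one> H" by (simp add: conj_by_one W)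
      then show "(H, H) \<in> r"
        using \<open>H \<in> W\<close> subgroup.one_closed[OF Q] unfolding r_def by blast
    qed
    show "sym r"
    proof (rule symI)
      fix H K assume "(H, K) \<in> r"
      then obtain x where x: "H \<in> W" "K \<in> W" "x \<in> Q" "K = conj_by G x H" by (auto simp: r_def)
      then have "H = conj_by G (inv x) K" using QG W by (simp add: conj_by_inv_cancel)
      then show "(K, H) \<in> r" using x subgroup.m_inv_closed[OF Q] unfolding r_def by blast
    qed
    show "trans r"
    proof (rule transI)
      fix H K L assume "(H, K) \<in> r" "(K, L) \<in> r"
      then obtain x y where "H \<in> W" "L \<in> W" "x \<in> Q" "K = conj_by G x H" "y \<in> Q" "L = conj_by G y K"
        by (auto simp: r_def)
      then have "L = conj_by G (y \<otimes> x) H" "y \<otimes> x \<in> Q" "H \<in> W" "L \<in> W"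
        using QG W subgroup.m_closed[OF Q] by (simp_all add: conj_by_mult)
      then show "(H, L) \<in> r" unfolding r_def by blast
    qed
  qed
  have "q dvd card X" if "X \<in> W // r" for X
  proof -
    from that obtain H where H: "H \<in> W" "X = r `` {H}" by (auto elim: quotientE)
    have X: "X = (\<lambda>x. conj_by G x H) ` Q" using H act by (auto simp: r_def)
    have "card X dvd q ^ n" unfolding X using card_conj_orbit[OF Q W[OF H(1)]] cQ by (metis dvd_triv_left)
    then obtain i where i: "card X = q ^ i" using q by (auto simp: divides_primepow_nat)
    have "card X \<noteq> 1"
    proof
      assume "card X = 1"
      then obtain K where K: "X = {K}" by (auto simp: card_1_singleton_iff)
      have "conj_by G x H = H" if "x \<in> Q" for x
      proof -
        have "H \<in> X" using H eq by (meson equiv_class_self)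
        moreover have "conj_by G x H \<in> X" using that X by blast
        ultimately show ?thesis using K by blast
      qed
      then show False using no H by blast
    qed
    then show ?thesis using i by (cases i) auto
  qed
  then have "q dvd card W" using equiv_imp_dvd_card[OF fin eq] by blast
  then show False using nd by simp
qed

text \<open>The \<open>p\<close>-group \<open>P\<close> permutes the conjugates of \<open>S\<close>,
  whose number is prime to \<open>p\<close>, so it normalizes one of them, \<open>T\<close>. Then
  \<open>P <#> T\<close> is a \<open>p\<close>-subgroup and cannot be larger than
  \<open>T\<close>.\<close>

lemma sylow_contains_conj:
  assumes fin: "finite (carrier G)" and p: "prime (p::nat)"
    and S: "subgroup S G" and cS: "card S = p ^ multiplicity p (order G)"
    and P: "subgroup P G" and cP: "card P = p ^ n"
  shows "\<exists>g \<in> carrier G. P \<subseteq> conj_by G g S"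
proof -
  have sub: "S \<subseteq> carrier G" by (rule subgroup.subset[OF S])
  have pos: "order G > 0" using fin by (simp add: order_gt_0_iff_finite)
  define W where "W = (\<lambda>x. conj_by G x S) ` carrier G"
  let ?N = "{x \<in> carrier G. conj_by G x S = S}"
  have oW: "card W * card ?N = order G"
    using card_conj_orbit[OF subgroup_self sub] by (simp add: W_def order_def)
  \<comment> \<open>Since \<open>S\<close> lies in its normalizer \<open>?N\<close>, a factor
    \<open>p\<close> of \<open>card W\<close> would yield a power of \<open>p\<close> dividing the
    order of \<open>G\<close> with too large an exponent.\<close>
  have "card S dvd card ?N"
    by (rule card_subgroup_dvd[OF S subgroup_conj_stabilizer[OF subgroup_self sub]])
       (use sub conj_by_self[OF S] in auto)
  then have nd: "\<not> p dvd card W"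
  proof (rule contrapos_pn)
    assume "p dvd card W"
    then have "p * card S dvd order G"
      unfolding oW[symmetric] using \<open>card S dvd card ?N\<close> by (rule mult_dvd_mono)
    then have "p ^ Suc (multiplicity p (order G)) dvd order G" using cS by simp
    then have "Suc (multiplicity p (order G)) \<le> multiplicity p (order G)"
      using pos p by (intro multiplicity_geI) auto
    then show "\<not> card S dvd card ?N" by simp
  qed
  have "\<exists>T \<in> W. \<forall>x \<in> P. conj_by G x T = T"
  proof (rule conj_fixed_point[OF P p cP _ _ _ nd])
    show "finite W" using fin by (simp add: W_def)
    show "H \<subseteq> carrier G" if "H \<in> W" for H using that sub by (auto simp: W_def conj_by_image)
    show "conj_by G x H \<in> W" if H: "H \<in> W" and "x \<in> P" for H x
    proof -
      have xG: "x \<in> carrier G" using that subgroup.subset[OF P] by auto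
      from H obtain y where "y \<in> carrier G" "H = conj_by G y S" by (auto simp: W_def)
      then show ?thesis using xG sub by (auto simp: W_def conj_by_mult)
    qed
  qed
  then obtain g where g: "g \<in> carrier G" and fixed: "\<And>x. x \<in> P \<Longrightarrow> conj_by G x (conj_by G g S) = conj_by G g S"
    by (auto simp: W_def)
  define T where "T = conj_by G g S"
  have T: "subgroup T G" unfolding T_def by (rule subgroup_conj_by[OF g S])
  have cT: "card T = p ^ multiplicity p (order G)" by (simp add: T_def card_conj_by g sub cS)
  have PT: "subgroup (P <#> T) G" by (rule subgroup_set_mult[OF P T]) (simp add: T_def fixed)
  have "card (P <#> T) dvd p ^ (n + multiplicity p (order G))"
    using card_set_mult[OF P T] cP cT by (metis dvd_triv_left power_add)
  then obtain i where i: "card (P <#> T) = p ^ i" using p by (auto simp: divides_primepow_nat)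
  have "p ^ i dvd order G" using card_subgroup_dvd_order[OF PT] i by simp
  then have "i \<le> multiplicity p (order G)" using pos p by (intro multiplicity_geI) auto
  then have "card (P <#> T) \<le> card T"
    using i cT p by (metis power_increasing prime_ge_1_nat)
  moreover have "finite (P <#> T)" using subgroup.subset[OF PT] fin by (rule finite_subset)
  ultimately have "T = P <#> T" using set_mult_supset(2)[OF P T] by (meson card_seteq)
  then have "P \<subseteq> T" using set_mult_supset(1)[OF P T] by simp
  then show ?thesis using g by (auto simp: T_def)
qed

text \<open>The transitivity is Sylow's theorem in the stabilizer \<open>U\<close> of \<open>H\<close> in \<open>RQ\<close>: both \<open>Q\<close> and the
  conjugate of \<open>Q\<close> by an element taking \<open>H'\<close> to \<open>H\<close> are Sylow subgroups of \<open>U\<close>.\<close>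

lemma coprime_action_fixed_points:
  assumes fin: "finite (carrier G)"
    and p: "prime (p::nat)" and R: "subgroup R G" and cR: "card R = p ^ m"
    and q: "prime (q::nat)" and Q: "subgroup Q G" and cQ: "card Q = q ^ n"
    and pq: "p \<noteq> q" and norm: "\<And>x. x \<in> Q \<Longrightarrow> conj_by G x R = R"
    and W: "\<And>H. H \<in> W \<Longrightarrow> H \<subseteq> carrier G" and ne: "W \<noteq> {}"
    and actQ: "\<And>H x. H \<in> W \<Longrightarrow> x \<in> Q \<Longrightarrow> conj_by G x H \<in> W"
    and actR: "\<And>H x. H \<in> W \<Longrightarrow> x \<in> R \<Longrightarrow> conj_by G x H \<in> W"
    and trans: "\<And>H H'. H \<in> W \<Longrightarrow> H' \<in> W \<Longrightarrow> \<exists>r \<in> R. H' = conj_by G r H"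
  shows "\<exists>H \<in> W. \<forall>x \<in> Q. conj_by G x H = H"
    and "\<And>H H'. H \<in> W \<Longrightarrow> H' \<in> W \<Longrightarrow> \<forall>x \<in> Q. conj_by G x H = H \<Longrightarrow> \<forall>x \<in> Q. conj_by G x H' = H' \<Longrightarrow>
      \<exists>r \<in> R. conj_by G r Q = Q \<and> H' = conj_by G r H"
proof -
  have subR: "R \<subseteq> carrier G" and subQ: "Q \<subseteq> carrier G"
    using R Q by (auto dest: subgroup.subset)
  show "\<exists>H \<in> W. \<forall>x \<in> Q. conj_by G x H = H"
  proof (rule conj_fixed_point[OF Q q cQ])
    show "finite W" by (rule finite_subset[of _ "Pow (carrier G)"]) (use W fin in auto)
    obtain H where H: "H \<in> W" using ne by blast
    \<comment> \<open>By transitivity \<open>W\<close> is a single orbit of the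
      \<open>p\<close>-group \<open>R\<close>, so its size is a power of \<open>p\<close> and prime
      to \<open>q\<close>.\<close>
    have WH: "W = (\<lambda>x. conj_by G x H) ` R" using trans[OF H] actR[OF H] by auto
    have "card W dvd p ^ m"
      unfolding WH using card_conj_orbit[OF R W[OF H]] cR by (metis dvd_triv_left)
    then show "\<not> q dvd card W"
      using p q pq by (metis dvd_trans prime_dvd_power primes_dvd_imp_eq)
  qed (use W actQ in auto)
  fix H H' assume H: "H \<in> W" "H' \<in> W"
    and fH: "\<forall>x \<in> Q. conj_by G x H = H" and fH': "\<forall>x \<in> Q. conj_by G x H' = H'"
  \<comment> \<open>The element \<open>s\<close> takes \<open>H\<close> to \<open>H'\<close> but may
    fail to normalize \<open>Q\<close>. It is corrected below, first by an element \<open>t\<close>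
    of the stabilizer \<open>U\<close>, then by an element of \<open>Q\<close>.\<close>
  obtain s where s: "s \<in> R" "H' = conj_by G s H" using trans[OF H] by blast
  have sG: "s \<in> carrier G" using s subR by auto
  have HG: "H \<subseteq> carrier G" using W H by blast
  define QR where "QR = Q <#> R"
  have QR: "subgroup QR G" unfolding QR_def by (rule subgroup_set_mult[OF Q R norm])
  have "coprime (card Q) (card R)" unfolding cQ cR using p q pq by (simp add: primes_coprime)
  moreover have "card (Q \<inter> R) dvd card Q" "card (Q \<inter> R) dvd card R"
    by (intro card_subgroup_dvd subgroups_Inter_pair Q R; blast)+
  ultimately have "card (Q \<inter> R) = 1" by (metis coprime_common_divisor nat_dvd_1_iff_1)
  then have cQR: "card QR = q ^ n * p ^ m" using card_set_mult[OF Q R] cQ cR by (simp add: QR_def)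
  define U where "U = {x \<in> QR. conj_by G x H = H}"
  have U: "subgroup U G" unfolding U_def by (rule subgroup_conj_stabilizer[OF QR HG])
  have UG: "U \<subseteq> carrier G" by (rule subgroup.subset[OF U])
  have QRs: "Q \<subseteq> QR" "R \<subseteq> QR" using set_mult_supset[OF Q R] by (auto simp: QR_def)
  have QU: "Q \<subseteq> U" using QRs fH by (auto simp: U_def)
  have sQU: "conj_by G (inv s) Q \<subseteq> U"
  proof
    fix y assume "y \<in> conj_by G (inv s) Q"
    then obtain x where x: "x \<in> Q" "y = inv s \<otimes> x \<otimes> s" using sG by (auto simp: conj_by_image)
    have xG: "x \<in> carrier G" using x subQ by auto
    have "inv s \<in> R" by (rule subgroup.m_inv_closed[OF R s(1)])
    then have "y \<in> QR" using x QRs s(1) subgroup.m_closed[OF QR] by (metis subsetD)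
    moreover have "conj_by G y H = conj_by G (inv s) (conj_by G x (conj_by G s H))"
      using x(2) xG sG HG by (simp add: conj_by_mult conj_by_subset m_assoc)
    then have "conj_by G y H = H"
      using fH' x(1) s(2) sG HG by (simp add: conj_by_inv_cancel)
    ultimately show "y \<in> U" by (simp add: U_def)
  qed
  interpret U: group "G\<lparr>carrier := U\<rparr>" by (rule subgroup_imp_group[OF U])
  have finU: "finite U" using UG fin by (rule finite_subset)
  have "card U > 0" using finU subgroup.one_closed[OF U] by (auto simp: card_gt_0_iff)
  have "multiplicity q (card U) = n"
  proof (rule antisym)
    have "card U dvd q ^ n * p ^ m"
      using card_subgroup_dvd[OF U QR] cQR by (auto simp: U_def)
    then have "multiplicity q (card U) \<le> multiplicity q (q ^ n * p ^ m)"
      using p q by (intro dvd_imp_multiplicity_le) auto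
    also have "\<dots> = n"
      using p q pq by (simp add: prime_elem_multiplicity_mult_distrib multiplicity_distinct_prime_power)
    finally show "multiplicity q (card U) \<le> n" .
    have "q ^ n dvd card U" using card_subgroup_dvd[OF Q U QU] cQ by simp
    then show "n \<le> multiplicity q (card U)"
      using \<open>card U > 0\<close> q by (intro multiplicity_geI) auto
  qed
  then have "\<exists>g \<in> U. conj_by G (inv s) Q \<subseteq> conj_by (G\<lparr>carrier := U\<rparr>) g Q"
    using U.sylow_contains_conj[of q Q "conj_by G (inv s) Q" n] finU q cQ subgroup_incl[OF Q U QU]
      subgroup_incl[OF subgroup_conj_by[OF _ Q] U sQU] sG subQ
    by (simp add: order_def card_conj_by)
  then obtain t where t: "t \<in> U" "conj_by G (inv s) Q \<subseteq> conj_by G t Q"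
    using U by (auto simp: conj_by_update)
  have tG: "t \<in> carrier G" using t UG by auto
  have "finite (conj_by G t Q)" using fin finite_subset[OF conj_by_subset[OF tG subQ]] by blast
  then have "conj_by G (inv s) Q = conj_by G t Q"
    using t(2) by (rule card_subset_eq) (simp add: card_conj_by sG tG subQ)
  then have stQ: "conj_by G (s \<otimes> t) Q = Q"
    using sG tG subQ by (metis conj_by_inv_cancel(2) conj_by_mult)
  \<comment> \<open>The product \<open>s \<otimes> t\<close> normalizes \<open>Q\<close> and takes
    \<open>H\<close> to \<open>H'\<close>, but lies only in \<open>QR\<close>. Factoring its inverse
    as \<open>x \<otimes> r'\<close> gives \<open>inv r' = s \<otimes> t \<otimes> x\<close>; as
    \<open>x\<close> preserves both \<open>Q\<close> and \<open>H\<close>, \<open>inv r'\<close> is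
    the desired element of \<open>R\<close>.\<close>
  have "inv (s \<otimes> t) \<in> QR"
    by (intro subgroup.m_inv_closed[OF QR] subgroup.m_closed[OF QR]) (use t(1) s(1) QRs in \<open>auto simp: U_def\<close>)
  then obtain x r' where x: "x \<in> Q" "r' \<in> R" "inv (s \<otimes> t) = x \<otimes> r'"
    by (auto simp: QR_def set_mult_def)
  have xG: "x \<in> carrier G" "r' \<in> carrier G" using x subQ subR by auto
  have "s \<otimes> t = inv (x \<otimes> r')" using x(3) sG tG by (metis inv_inv m_closed)
  then have st: "inv r' = s \<otimes> t \<otimes> x" using xG by (simp add: inv_mult_group m_assoc)
  have "conj_by G (inv r') Q = conj_by G (s \<otimes> t) (conj_by G x Q)"
    using st sG tG xG subQ by (simp add: conj_by_mult)
  then have "conj_by G (inv r') Q = Q" using stQ conj_by_self[OF Q x(1)] by simp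
  moreover have "conj_by G (inv r') H = conj_by G s (conj_by G t (conj_by G x H))"
    using st sG tG xG HG by (simp add: conj_by_mult m_assoc conj_by_subset)
  then have "conj_by G (inv r') H = H'" using fH x(1) t(1) s(2) by (simp add: U_def)
  ultimately show "\<exists>r \<in> R. conj_by G r Q = Q \<and> H' = conj_by G r H"
    using subgroup.m_inv_closed[OF R x(2)] by blast
qed

section \<open>Towers of subgroups for descending primes\<close>

text \<open>\<open>W F\<close> collects the \<open>P\<close>-conjugates of \<open>I\<close>
  normalized by every \<open>S q\<close> with \<open>q\<close> in \<open>F\<close>, and
  \<open>R F\<close> is the part of \<open>P\<close> normalizing all these \<open>S q\<close>.
  Nonemptiness alone does not pass through the induction: a fixed point for the next prime requires
  the size of \<open>W F\<close> to be prime to it, which follows from transitivity of the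
  \<open>p\<close>-group \<open>R F\<close>. The induction rule adds a new least prime each time, so
  the new Sylow subgroup normalizes the earlier ones.\<close>

lemma intense_tower_fixed_conj:
  fixes S :: "nat \<Rightarrow> 'a set"
  assumes fin: "finite (carrier G)" and p: "prime (p::nat)" and P: "subgroup P G" and cP: "card P = p ^ m"
    and I: "subgroup I G" "I \<subseteq> P" and "finite F"
    and "\<And>q. q \<in> F \<Longrightarrow> prime q \<and> q \<noteq> p \<and> subgroup (S q) G \<and> (\<exists>e. card (S q) = q ^ e)"
    and "\<And>q r x. q \<in> F \<Longrightarrow> r \<in> F \<Longrightarrow> q < r \<Longrightarrow> x \<in> S q \<Longrightarrow> conj_by G x (S r) = S r"
    and "\<And>q x. q \<in> F \<Longrightarrow> x \<in> S q \<Longrightarrow> conj_by G x P = P"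
    and "\<And>q x H. q \<in> F \<Longrightarrow> x \<in> S q \<Longrightarrow> subgroup H G \<Longrightarrow> H \<subseteq> P \<Longrightarrow> \<exists>y \<in> P. conj_by G x H = conj_by G y H"
  defines "W \<equiv> \<lambda>F. {H. (\<exists>s \<in> P. H = conj_by G s I) \<and> (\<forall>q \<in> F. \<forall>x \<in> S q. conj_by G x H = H)}"
    and "R \<equiv> \<lambda>F. {r \<in> P. \<forall>q \<in> F. conj_by G r (S q) = S q}"
  shows "W F \<noteq> {} \<and> (\<forall>H \<in> W F. \<forall>H' \<in> W F. \<exists>r \<in> R F. H' = conj_by G r H)"
  using assms(7-11)
proof (induction F rule: finite_linorder_min_induct)
  have PG: "P \<subseteq> carrier G" and IG: "I \<subseteq> carrier G" using P I by (auto dest: subgroup.subset)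
  case empty
  have "conj_by G \<one> I \<in> W {}" using subgroup.one_closed[OF P] by (auto simp: W_def)
  moreover have "\<exists>r \<in> R {}. H' = conj_by G r H" if HH: "H \<in> W {}" "H' \<in> W {}" for H H'
  proof -
    obtain s s' where s: "s \<in> P" "s' \<in> P" "H = conj_by G s I" "H' = conj_by G s' I"
      using HH by (auto simp: W_def)
    have "s \<in> carrier G" "s' \<in> carrier G" using s PG by auto
    then have "conj_by G (s' \<otimes> inv s) H = conj_by G s' (conj_by G (inv s) H)"
      using s IG by (intro conj_by_mult[symmetric]) (auto simp: conj_by_subset)
    also have "\<dots> = H'" using s PG IG by (auto simp: conj_by_inv_cancel)
    finally have "H' = conj_by G (s' \<otimes> inv s) H" ..
    moreover have "s' \<otimes> inv s \<in> R {}"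
      using s P by (simp add: R_def subgroup.m_closed subgroup.m_inv_closed)
    ultimately show ?thesis by blast
  qed
  ultimately show ?case by blast
next
  have PG: "P \<subseteq> carrier G" and IG: "I \<subseteq> carrier G" using P I by (auto dest: subgroup.subset)
  case (insert b F)
  have bF: "b \<notin> F" using insert.hyps by auto
  have SG: "S q \<subseteq> carrier G" if "q \<in> insert b F" for q
    using insert.prems(1)[OF that] by (blast dest: subgroup.subset)
  have "W F \<noteq> {} \<and> (\<forall>H \<in> W F. \<forall>H' \<in> W F. \<exists>r \<in> R F. H' = conj_by G r H)"
    by (rule insert.IH, erule insert.prems(1)[OF insertI2], erule (3) insert.prems(2)[OF insertI2 insertI2],
        erule (1) insert.prems(3)[OF insertI2], erule (3) insert.prems(4)[OF insertI2])
  then have IH: "W F \<noteq> {}" "\<And>H H'. H \<in> W F \<Longrightarrow> H' \<in> W F \<Longrightarrow> \<exists>r \<in> R F. H' = conj_by G r H"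
    by blast+
  have WG: "H \<subseteq> carrier G" "subgroup H G" "H \<subseteq> P" if "H \<in> W F" for H
  proof -
    from that obtain s where s: "s \<in> P" "H = conj_by G s I" by (auto simp: W_def)
    have sG: "s \<in> carrier G" using s PG by auto
    show "subgroup H G" using subgroup_conj_by[OF sG I(1)] s by simp
    then show "H \<subseteq> carrier G" by (rule subgroup.subset)
    show "H \<subseteq> P" using conj_by_mono[OF I(2), of s] s conj_by_self[OF P s(1)] by simp
  qed
  have RF: "subgroup (R F) G"
    using insert.hyps(1) SG unfolding R_def
  proof (induction F rule: finite_induct)
    case empty then show ?case using P by simp
  next
    case (insert q F)
    then have "subgroup ({r \<in> P. \<forall>q \<in> F. conj_by G r (S q) = S q} \<inter> {r \<in> P. conj_by G r (S q) = S q}) G"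
      by (intro subgroups_Inter_pair subgroup_conj_stabilizer P) auto
    moreover have "{r \<in> P. \<forall>q \<in> F. conj_by G r (S q) = S q} \<inter> {r \<in> P. conj_by G r (S q) = S q}
        = {r \<in> P. \<forall>q \<in> insert q F. conj_by G r (S q) = S q}"
      by blast
    ultimately show ?case by simp
  qed
  have "card (R F) dvd p ^ m"
    using card_subgroup_dvd[OF RF P] cP by (auto simp: R_def)
  then obtain k where k: "card (R F) = p ^ k" using p by (auto simp: divides_primepow_nat)
  obtain e where b: "prime b" "b \<noteq> p" "subgroup (S b) G" "card (S b) = b ^ e"
    using insert.prems(1)[of b] by auto
  have conjS: "conj_by G (x \<otimes> r \<otimes> inv x) (S q) = S q"
    if "x \<in> carrier G" "r \<in> carrier G" "q \<in> insert b F" "conj_by G x (S q) = S q" "conj_by G r (S q) = S q" for x r q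
  proof -
    have "conj_by G (inv x) (S q) = S q" using that SG by (metis conj_by_inv_cancel(1))
    then show ?thesis using that SG[OF that(3)] by (simp add: conj_by_mult[symmetric])
  qed
  \<comment> \<open>As \<open>b\<close> is below all primes in \<open>F\<close>, \<open>S b\<close>
    normalizes \<open>P\<close> and every \<open>S q\<close>, hence also the intersection of their
    normalizers with \<open>P\<close>.\<close>
  have bR: "conj_by G x (R F) = R F" if x: "x \<in> S b" for x
  proof -
    have cl: "conj_by G x (R F) \<subseteq> R F" if x: "x \<in> S b" for x
    proof
      have xG: "x \<in> carrier G" using x SG by auto
      fix y assume "y \<in> conj_by G x (R F)"
      then obtain r where r: "r \<in> R F" "y = x \<otimes> r \<otimes> inv x" by (auto simp: conj_by_image)
      then have rP: "r \<in> P" "r \<in> carrier G" using PG by (auto simp: R_def)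
      have "y \<in> conj_by G x P" using r rP by (auto simp: conj_by_image)
      then have "y \<in> P" using insert.prems(3)[of b x] x by simp
      moreover have "conj_by G y (S q) = S q" if "q \<in> F" for q
        unfolding r(2)
        by (rule conjS[OF xG rP(2)])
           (use that r insert.prems(2)[of b q x] insert.hyps(2) x in \<open>auto simp: R_def\<close>)
      ultimately show "y \<in> R F" by (simp add: R_def)
    qed
    have xG: "x \<in> carrier G" using x SG by auto
    have "R F = conj_by G x (conj_by G (inv x) (R F))"
      using xG subgroup.subset[OF RF] by (simp add: conj_by_inv_cancel)
    also have "\<dots> \<subseteq> conj_by G x (R F)"
      by (intro conj_by_mono cl subgroup.m_inv_closed[OF b(3) x])
    finally show ?thesis using cl[OF x] by blast
  qed
  \<comment> \<open>Conjugation by an element normalizing \<open>S q\<close> preserves the property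
    of being normalized by \<open>S q\<close>. Both actions on \<open>W F\<close>, by
    \<open>S b\<close> and by \<open>R F\<close>, rely on this.\<close>
  have move: "conj_by G x (conj_by G y H) = conj_by G y H"
    if "x \<in> S q" "q \<in> F" "y \<in> carrier G" "conj_by G y (S q) = S q" "H \<in> W F" for x y H q
  proof -
    from that(1,4) obtain z where z: "z \<in> S q" "x = y \<otimes> z \<otimes> inv y" by (auto simp: conj_by_image)
    have "z \<in> carrier G" using z SG[of q] that(2) by auto
    then have "conj_by G x (conj_by G y H) = conj_by G y (conj_by G z H)"
      using z that WG(1)[OF that(5)] by (simp add: conj_by_mult m_assoc)
    also have "conj_by G z H = H" using z that by (auto simp: W_def)
    finally show ?thesis .
  qed
  \<comment> \<open>Two descriptions of one conjugate are combined: through \<open>y\<close> in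
    \<open>P\<close> it is again a \<open>P\<close>-conjugate of \<open>I\<close>, while through
    \<open>x\<close>, which normalizes each \<open>S q\<close>, it is seen to be normalized by
    \<open>S q\<close>. Nothing of the latter kind is known for \<open>y\<close>.\<close>
  have actb: "conj_by G x H \<in> W F" if H: "H \<in> W F" and x: "x \<in> S b" for H x
  proof -
    have xG: "x \<in> carrier G" using x SG by auto
    obtain s where s: "s \<in> P" "H = conj_by G s I" using H by (auto simp: W_def)
    obtain y where y: "y \<in> P" "conj_by G x H = conj_by G y H"
      using insert.prems(4)[of b x H] x WG[OF H] by auto
    have "conj_by G x H = conj_by G (y \<otimes> s) I" using s y IG by (simp add: conj_by_mult subsetD[OF PG])
    moreover have "y \<otimes> s \<in> P" using s y P by (simp add: subgroup.m_closed)
    moreover have "conj_by G z (conj_by G x H) = conj_by G x H" if "q \<in> F" "z \<in> S q" for q z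
      by (rule move[OF that(2,1) xG _ H]) (use insert.prems(2)[of b q x] insert.hyps(2) that x in auto)
    ultimately show ?thesis by (auto simp: W_def)
  qed
  have actR: "conj_by G x H \<in> W F" if H: "H \<in> W F" and x: "x \<in> R F" for H x
  proof -
    have xP: "x \<in> P" "x \<in> carrier G" using x PG by (auto simp: R_def)
    obtain s where s: "s \<in> P" "H = conj_by G s I" using H by (auto simp: W_def)
    have "conj_by G x H = conj_by G (x \<otimes> s) I" using s xP IG by (simp add: conj_by_mult subsetD[OF PG])
    moreover have "x \<otimes> s \<in> P" using s xP P by (simp add: subgroup.m_closed)
    moreover have "conj_by G z (conj_by G x H) = conj_by G x H" if "q \<in> F" "z \<in> S q" for q z
      by (rule move[OF that(2,1) xP(2) _ H]) (use that x in \<open>auto simp: R_def\<close>)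
    ultimately show ?thesis by (auto simp: W_def)
  qed
  note fp = coprime_action_fixed_points[OF fin p RF k b(1,3,4) b(2)[symmetric] bR WG(1) IH(1) actb actR IH(2)]
  have Wi: "H \<in> W (insert b F) \<longleftrightarrow> H \<in> W F \<and> (\<forall>x \<in> S b. conj_by G x H = H)" for H
    by (auto simp: W_def)
  have Ri: "r \<in> R (insert b F) \<longleftrightarrow> r \<in> R F \<and> conj_by G r (S b) = S b" for r
    by (auto simp: R_def)
  show ?case
  proof (intro conjI ballI)
    show "W (insert b F) \<noteq> {}" using fp(1) Wi by blast
    fix H H' assume "H \<in> W (insert b F)" "H' \<in> W (insert b F)"
    then have "\<exists>r \<in> R F. conj_by G r (S b) = S b \<and> H' = conj_by G r H"
      using fp(2)[of H H'] unfolding Wi by blast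
    then show "\<exists>r \<in> R (insert b F). H' = conj_by G r H" using Ri by blast
  qed
qed

text \<open>Primes enter in descending order, so each new factor normalizes all earlier ones; the
  last clause turns this into normalizing their product \<open>J\<close>. Orders multiply because
  the new factor and \<open>J\<close> have coprime orders.\<close>

lemma tower_product:
  fixes A :: "nat \<Rightarrow> 'a set"
  assumes fin: "finite (carrier G)" and "finite F"
    and "\<And>q. q \<in> F \<Longrightarrow> prime q \<and> subgroup (A q) G \<and> (\<exists>e. card (A q) = q ^ e)"
    and "\<And>q r x. q \<in> F \<Longrightarrow> r \<in> F \<Longrightarrow> q < r \<Longrightarrow> x \<in> A q \<Longrightarrow> conj_by G x (A r) = A r"
  shows "\<exists>J. subgroup J G \<and> (\<forall>q \<in> F. A q \<subseteq> J) \<and> card J = (\<Prod>q \<in> F. card (A q)) \<and>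
    (\<forall>x \<in> carrier G. (\<forall>q \<in> F. conj_by G x (A q) = A q) \<longrightarrow> conj_by G x J = J)"
  using assms(2-4)
proof (induction F rule: finite_linorder_min_induct)
  case empty
  have "subgroup {\<one>} G" by (rule triv_subgroup)
  then show ?case by (intro exI[of _ "{\<one>}"]) (simp add: conj_by_image)
next
  case (insert b F)
  have bF: "b \<notin> F" using insert.hyps by auto
  have "\<exists>J. subgroup J G \<and> (\<forall>q \<in> F. A q \<subseteq> J) \<and> card J = (\<Prod>q \<in> F. card (A q)) \<and>
    (\<forall>x \<in> carrier G. (\<forall>q \<in> F. conj_by G x (A q) = A q) \<longrightarrow> conj_by G x J = J)"
    by (rule insert.IH, erule insert.prems(1)[OF insertI2], erule (3) insert.prems(2)[OF insertI2 insertI2])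
  then obtain J where J: "subgroup J G" "\<And>q. q \<in> F \<Longrightarrow> A q \<subseteq> J" "card J = (\<Prod>q \<in> F. card (A q))"
    and nJ: "\<And>x. x \<in> carrier G \<Longrightarrow> \<forall>q \<in> F. conj_by G x (A q) = A q \<Longrightarrow> conj_by G x J = J"
    by blast
  obtain e where b: "prime b" "subgroup (A b) G" "card (A b) = b ^ e"
    using insert.prems(1)[of b] by auto
  have bG: "A b \<subseteq> carrier G" and JG: "J \<subseteq> carrier G" using b J by (auto dest: subgroup.subset)
  have "conj_by G x J = J" if "x \<in> A b" for x
    by (rule nJ) (use that bG insert.prems(2)[of b _ x] insert.hyps(2) in auto)
  then have bJ: "subgroup (A b <#> J) G" by (rule subgroup_set_mult[OF b(2) J(1)])
  have "coprime (card (A b)) (card J)"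
    unfolding J(3)
  proof (rule prod_coprime_right)
    fix q assume "q \<in> F"
    then show "coprime (card (A b)) (card (A q))"
      using insert.prems(1)[of q] b bF by (metis coprime_power_left_iff coprime_power_right_iff insertI2 primes_coprime)
  qed
  moreover have "card (A b \<inter> J) dvd card (A b)" "card (A b \<inter> J) dvd card J"
    by (intro card_subgroup_dvd subgroups_Inter_pair b J; blast)+
  ultimately have "card (A b \<inter> J) = 1" by (metis coprime_common_divisor nat_dvd_1_iff_1)
  then have c: "card (A b <#> J) = (\<Prod>q \<in> insert b F. card (A q))"
    using card_set_mult[OF b(2) J(1)] J(3) insert.hyps(1) bF by simp
  show ?case
    using set_mult_supset[OF b(2) J(1)] J(2) bJ c bG JG
    by (intro exI[of _ "A b <#> J"]) (auto simp: conj_by_set_mult nJ)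
qed

subsection \<open>Evolving groups\<close>

lemma subgroup_index_iff:
  assumes "finite (carrier G)" "subgroup J G"
  shows "subgroup_index G J = k \<longleftrightarrow> order G = card J * k"
proof -
  have "card J > 0" by (rule subgroup.finite_imp_card_positive[OF assms(2,1)])
  moreover have "order G = card J * subgroup_index G J"
    using lagrange[OF assms(2)] by (simp add: subgroup_index_def mult.commute)
  ultimately show ?thesis by auto
qed

lemma subgroup_index_update_iff:
  assumes "finite (carrier G)" "subgroup J G" "subgroup I G" "I \<subseteq> J"
  shows "subgroup_index (G\<lparr>carrier := J\<rparr>) I = k \<longleftrightarrow> card J = card I * k"
  using group.subgroup_index_iff[OF subgroup_imp_group[OF assms(2)], of I k]
    subgroup_incl[OF assms(3,2,4)] finite_subset[OF subgroup.subset[OF assms(2)] assms(1)]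
  by (simp add: order_def)

text \<open>Lagrange's theorem turns both indices into factorizations of orders, so the arguments
  below compare cardinalities and do not count cosets.\<close>

lemma evolving_iff:
  assumes fin: "finite (carrier G)"
  shows "evolving G \<longleftrightarrow> (\<forall>p I n. prime p \<longrightarrow> subgroup I G \<longrightarrow> card I = p ^ n \<longrightarrow>
    (\<exists>J k c. subgroup J G \<and> I \<subseteq> J \<and> order G = card J * p ^ k \<and> card J = card I * c \<and> coprime c p))"
    (is "_ \<longleftrightarrow> ?R")
proof
  assume ev: "evolving G"
  show ?R
  proof (intro allI impI)
    fix p n :: nat and I assume pI: "prime p" "subgroup I G" "card I = p ^ n"
    then obtain J k where J: "subgroup J G" "I \<subseteq> J" "subgroup_index G J = p ^ k"
        "coprime (subgroup_index (G\<lparr>carrier := J\<rparr>) I) p"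
      using ev unfolding evolving_def p_subgroup_def by blast
    then show "\<exists>J k c. subgroup J G \<and> I \<subseteq> J \<and> order G = card J * p ^ k \<and> card J = card I * c \<and> coprime c p"
      using subgroup_index_iff[OF fin J(1)] subgroup_index_update_iff[OF fin J(1) pI(2) J(2)] by blast
  qed
next
  assume R: ?R
  show "evolving G"
    unfolding evolving_def p_subgroup_def
  proof (intro conjI allI impI fin is_group, elim conjE exE)
    fix p n :: nat and I assume pI: "prime p" "subgroup I G" "card I = p ^ n"
    then obtain J k c where J: "subgroup J G" "I \<subseteq> J" "order G = card J * p ^ k" "card J = card I * c" "coprime c p"
      using R by blast
    then have "subgroup_index G J = p ^ k" "subgroup_index (G\<lparr>carrier := J\<rparr>) I = c"
      using subgroup_index_iff[OF fin J(1)] subgroup_index_update_iff[OF fin J(1) pI(2) J(2)] by blast+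
    then show "\<exists>J. subgroup J G \<and> I \<subseteq> J \<and> (\<exists>n. subgroup_index G J = p ^ n) \<and>
        coprime (subgroup_index (G\<lparr>carrier := J\<rparr>) I) p"
      using J by blast
  qed
qed

lemma evolvingD:
  assumes "evolving G" "prime p" "subgroup I G" "card I = p ^ n"
  obtains J k c where "subgroup J G" "I \<subseteq> J" "order G = card J * p ^ k" "card J = card I * c" "coprime c p"
  using assms evolving_iff evolving_def by metis

text \<open>If \<open>J\<close> serves for \<open>I\<close> in \<open>G\<close>, then
  \<open>J \<inter> N\<close> serves in \<open>N\<close>: its index in \<open>N\<close> equals |JN :
  J|, a divisor of |G : J|, and |J \<inter> N : I| divides |J : I|.\<close>

lemma evolving_normal_subgroup:
  assumes ev: "evolving G" and N: "N \<lhd> G"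
  shows "evolving (G\<lparr>carrier := N\<rparr>)"
proof -
  have fin: "finite (carrier G)" using ev by (simp add: evolving_def)
  have sN: "subgroup N G" by (rule normal_imp_subgroup[OF N])
  interpret N: group "G\<lparr>carrier := N\<rparr>" by (rule subgroup_imp_group[OF sN])
  have finN: "finite N" using subgroup.subset[OF sN] fin by (rule finite_subset)
  have "\<exists>J k c. subgroup J (G\<lparr>carrier := N\<rparr>) \<and> I \<subseteq> J \<and> order (G\<lparr>carrier := N\<rparr>) = card J * p ^ k \<and>
      card J = card I * c \<and> coprime c p"
    if p: "prime p" and I: "subgroup I (G\<lparr>carrier := N\<rparr>)" "card I = p ^ n" for p I n
  proof -
    have IG: "subgroup I G" by (rule incl_subgroup[OF sN I(1)])
    have IN: "I \<subseteq> N" using subgroup.subset[OF I(1)] by simp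
    obtain J k c where J: "subgroup J G" "I \<subseteq> J" "order G = card J * p ^ k" "card J = card I * c" "coprime c p"
      using evolvingD[OF ev p IG I(2)] .
    have JN: "subgroup (J \<inter> N) G" by (rule subgroups_Inter_pair[OF J(1) sN])
    have "conj_by G x N = N" if "x \<in> J" for x
      using normal_conj_by[OF N] that subgroup.subset[OF J(1)] by auto
    then have prod: "subgroup (J <#> N) G" by (rule subgroup_set_mult[OF J(1) sN])
    obtain e where e: "card (J <#> N) = card J * e"
      using card_subgroup_dvd[OF J(1) prod set_mult_supset(1)[OF J(1) sN]] by auto
    have cJ: "card J > 0" by (rule subgroup.finite_imp_card_positive[OF J(1) fin])
    have "card J * e dvd card J * p ^ k" using card_subgroup_dvd_order[OF prod] e J(3) by simp
    then have "e dvd p ^ k" using cJ by simp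
    then obtain i where i: "e = p ^ i" using p by (auto simp: divides_primepow_nat)
    have "card J * (e * card (J \<inter> N)) = card J * card N"
      using card_set_mult[OF J(1) sN] e by (simp add: mult.assoc)
    then have oN: "order (G\<lparr>carrier := N\<rparr>) = card (J \<inter> N) * p ^ i" using cJ i by (simp add: order_def mult.commute)
    have IJN: "I \<subseteq> J \<inter> N" using J(2) IN by simp
    obtain c1 where c1: "card (J \<inter> N) = card I * c1"
      using card_subgroup_dvd[OF IG JN IJN] by auto
    obtain c2 where c2: "card J = card (J \<inter> N) * c2"
      using card_subgroup_dvd[OF JN J(1)] by auto
    have "card I > 0" using I(2) p by (simp add: prime_gt_0_nat)
    moreover have "card I * (c1 * c2) = card I * c" using J(4) c1 c2 by (simp add: mult.assoc)
    ultimately have "c1 * c2 = c" by simp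
    then have "coprime c1 p" using J(5) by auto
    then show ?thesis using subgroup_incl[OF JN sN] IJN oN c1 by blast
  qed
  then show ?thesis using N.evolving_iff finN by auto
qed

section \<open>Normality of the Sylow subgroup for the largest prime\<close>

text \<open>This is the normal core of \<open>J\<close>. Described by the conjugates of single
  elements, it is normal because replacing \<open>g\<close> by \<open>g \<otimes> x\<close> only
  permutes the conditions.\<close>

lemma core_subgroup:
  assumes J: "subgroup J G"
  shows "{x \<in> carrier G. \<forall>g \<in> carrier G. g \<otimes> x \<otimes> inv g \<in> J} \<lhd> G" (is "?N \<lhd> G")
proof (rule normal_invI)
  show "subgroup ?N G"
  proof (rule subgroupI)
    show "?N \<subseteq> carrier G" by blast
    have "\<one> \<in> ?N" using subgroup.one_closed[OF J] by simp
    then show "?N \<noteq> {}" by blast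
    fix a assume a: "a \<in> ?N"
    have "g \<otimes> inv a \<otimes> inv g = inv (g \<otimes> a \<otimes> inv g)" if "g \<in> carrier G" for g
      using that a by (simp add: inv_mult_group m_assoc)
    then show "inv a \<in> ?N" using a subgroup.m_inv_closed[OF J] by simp
    fix b assume b: "b \<in> ?N"
    have "g \<otimes> (a \<otimes> b) \<otimes> inv g = (g \<otimes> a \<otimes> inv g) \<otimes> (g \<otimes> b \<otimes> inv g)" if "g \<in> carrier G" for g
    proof -
      have "inv g \<otimes> (g \<otimes> (b \<otimes> inv g)) = b \<otimes> inv g" using that b by (simp add: m_assoc[symmetric])
      then show ?thesis using that a b by (simp add: m_assoc)
    qed
    then show "a \<otimes> b \<in> ?N" using a b subgroup.m_closed[OF J] by simp
  qed
  fix x h assume x: "x \<in> carrier G" and h: "h \<in> ?N"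
  have "g \<otimes> (x \<otimes> h \<otimes> inv x) \<otimes> inv g = (g \<otimes> x) \<otimes> h \<otimes> inv (g \<otimes> x)" if "g \<in> carrier G" for g
    using that x h by (simp add: inv_mult_group m_assoc)
  then show "x \<otimes> h \<otimes> inv x \<in> ?N" using x h by auto
qed

text \<open>The index of \<open>P \<inter> J\<close> in \<open>P\<close> is a power of
  \<open>p\<close>. It equals |PJ| / |J|, which is at most \<open>q < p\<close>, so it is 1.\<close>

lemma p_subgroup_subset_small_index:
  assumes fin: "finite (carrier G)" and J: "subgroup J G" and oG: "order G = card J * q"
    and P: "subgroup P G" "card P = p ^ n" and p: "prime p" and "q < p"
  shows "P \<subseteq> J"
proof -
  have PJ: "subgroup (P \<inter> J) G" by (rule subgroups_Inter_pair[OF P(1) J])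
  have finP: "finite P" using subgroup.subset[OF P(1)] fin by (rule finite_subset)
  obtain e where e: "card P = card (P \<inter> J) * e"
    using card_subgroup_dvd[OF PJ P(1)] by auto
  have "e dvd p ^ n" using e P(2) by (metis dvd_triv_right)
  then obtain i where i: "e = p ^ i" using p by (auto simp: divides_primepow_nat)
  have c: "card J > 0" "card (P \<inter> J) > 0"
    by (rule subgroup.finite_imp_card_positive[OF J fin], rule subgroup.finite_imp_card_positive[OF PJ fin])
  have sub: "P <#> J \<subseteq> carrier G"
    by (rule setmult_subset_G) (use subgroup.subset[OF P(1)] subgroup.subset[OF J] in auto)
  have "card (P <#> J) * card (P \<inter> J) = e * card J * card (P \<inter> J)"
    unfolding card_set_mult[OF P(1) J] e by simp
  then have "card (P <#> J) = e * card J" using c(2) by (metis less_irrefl mult_cancel2)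
  then have "e * card J = card (P <#> J)" ..
  also have "\<dots> \<le> order G" unfolding order_def using fin sub by (rule card_mono)
  finally have "e \<le> q" using oG c by simp
  then have "p ^ i < p" using i \<open>q < p\<close> by simp
  then have "i = 0" using p by (cases i) (auto simp: prime_gt_0_nat)
  then have "card (P \<inter> J) = card P" using e i by simp
  then have "P \<inter> J = P" using finP by (intro card_subset_eq) auto
  then show ?thesis by blast
qed

lemma p_subgroup_subset_normal_sylow:
  assumes fin: "finite (carrier G)" and p: "prime p"
    and P: "P \<lhd> G" "card P = p ^ multiplicity p (order G)"
    and Q: "subgroup Q G" "card Q = p ^ n"
  shows "Q \<subseteq> P"
proof -
  have sP: "subgroup P G" by (rule normal_imp_subgroup[OF P(1)])
  obtain g where "g \<in> carrier G" "Q \<subseteq> conj_by G g P"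
    using sylow_contains_conj[OF fin p sP P(2) Q] by blast
  then show ?thesis using normal_conj_by[OF P(1)] by simp
qed

end

text \<open>The prime \<open>p\<close> is only required to bound the prime divisors of the order, a
  condition inherited at once by the normal core to which the induction is applied.\<close>

lemma evolving_normal_sylow:
  fixes G :: "('a, 'b) monoid_scheme"
  assumes "evolving G" and p: "prime p" and "\<And>q. prime q \<Longrightarrow> q dvd order G \<Longrightarrow> q \<le> p"
  shows "\<exists>P. P \<lhd> G \<and> card P = p ^ multiplicity p (order G)"
  using assms(1,3)
proof (induction "order G" arbitrary: G rule: less_induct)
  case less
  then have G: "group G" and fin: "finite (carrier G)" by (auto simp: evolving_def)
  interpret group G by (rule G)
  have pos: "order G > 0" using fin by (simp add: order_gt_0_iff_finite)
  show ?case
  proof (cases "\<exists>q. prime q \<and> q dvd order G \<and> q \<noteq> p")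
    case False
    have "carrier G \<lhd> G" by (rule normal_invI[OF subgroup_self]) auto
    moreover have "card (carrier G) = p ^ multiplicity p (order G)"
    proof -
      have "prime_factors (order G) \<subseteq> {p}" using False by (auto simp: in_prime_factors_iff)
      then have "(\<Prod>q \<in> prime_factors (order G). q ^ multiplicity q (order G)) = p ^ multiplicity p (order G)"
      \<comment> \<open>Here the order is a power of \<open>p\<close>, possibly 1; in that case
        there are no prime factors and the exponent is 0.\<close>
      proof (cases "prime_factors (order G) = {}")
        case True
        then have "\<not> p dvd order G" using p pos prime_factorsI[of "order G" p] by (metis empty_iff less_irrefl)
        then show ?thesis using True by (simp add: not_dvd_imp_multiplicity_0)
      qed (auto dest: subset_singletonD)
      then show ?thesis using pos prod_prime_factors[of "order G"] by (simp add: order_def)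
    qed
    ultimately show ?thesis by blast
  next
    case True
    then obtain q where q: "prime q" "q dvd order G" "q \<noteq> p" by blast
    then have "q < p" using less.prems(2)[of q] by simp
    define a where "a = multiplicity q (order G)"
    have a: "a \<ge> 1" using q pos unfolding a_def by (intro multiplicity_geI) auto
    obtain m where m: "order G = q ^ (a - 1) * m"
      using multiplicity_dvd'[of "a - 1" q "order G"] by (auto simp: a_def elim: dvdE)
    \<comment> \<open>The order of \<open>I\<close> falls short of the full \<open>q\<close>-part by
      exactly one factor \<open>q\<close>. As \<open>J\<close> has the same \<open>q\<close>-part as
      \<open>I\<close> and its index is a power of \<open>q\<close>, that index is \<open>q\<close>
      itself.\<close>
    obtain I where I: "subgroup I G" "card I = q ^ (a - 1)"
      using sylow_thm[OF q(1) G m fin] by blast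
    obtain J k c where J: "subgroup J G" "I \<subseteq> J" "order G = card J * q ^ k" "card J = card I * c" "coprime c q"
      using evolvingD[OF less.prems(1) q(1) I] .
    have "\<not> q dvd c" using J pos q(1) by (auto simp: prime_nat_iff coprime_absorb_right)
    have "order G = q ^ (a - 1 + k) * c" using J I by (simp add: power_add)
    then have "a = a - 1 + k"
      using multiplicity_power_times[OF q(1) \<open>\<not> q dvd c\<close>, of "a - 1 + k"] by (simp add: a_def)
    then have "k = 1" using a by linarith
    then have oG: "order G = card J * q" using J(3) by simp
    define N where "N = {x \<in> carrier G. \<forall>g \<in> carrier G. g \<otimes>\<^bsub>G\<^esub> x \<otimes>\<^bsub>G\<^esub> inv\<^bsub>G\<^esub> g \<in> J}"
    have N: "N \<lhd> G" unfolding N_def by (rule core_subgroup[OF J(1)])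
    have sN: "subgroup N G" by (rule normal_imp_subgroup[OF N])
    have NG: "N \<subseteq> carrier G" by (rule subgroup.subset[OF sN])
    interpret N: group "G\<lparr>carrier := N\<rparr>" by (rule subgroup_imp_group[OF sN])
    have finN: "finite N" using NG fin by (rule finite_subset)
    have NJ: "N \<subseteq> J" by (auto simp: N_def dest: bspec[of _ _ "\<one>\<^bsub>G\<^esub>"])
    have "card N \<le> card J"
      using NJ subgroup.subset[OF J(1)] fin by (meson card_mono finite_subset)
    moreover have "card J < order G"
      using oG pos q(1) by (simp add: prime_gt_Suc_0_nat)
    ultimately have lt: "order (G\<lparr>carrier := N\<rparr>) < order G" by (simp add: order_def)
    have dN: "card N dvd order G" by (rule card_subgroup_dvd_order[OF sN])
    have pN: "Q \<subseteq> N" if Q: "subgroup Q G" "card Q = p ^ n" for Q n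
    proof
      fix x assume x: "x \<in> Q"
      have QG: "Q \<subseteq> carrier G" by (rule subgroup.subset[OF Q(1)])
      have "conj_by G g Q \<subseteq> J" if "g \<in> carrier G" for g
        using p_subgroup_subset_small_index[OF fin J(1) oG subgroup_conj_by[OF that Q(1)] _ p \<open>q < p\<close>]
          Q(2) card_conj_by[OF that QG] by simp
      then show "x \<in> N" using x QG by (auto simp: N_def conj_by_image)
    qed
    obtain P0 where P0: "P0 \<lhd> G\<lparr>carrier := N\<rparr>" "card P0 = p ^ multiplicity p (card N)"
    proof -
      have "\<exists>P. P \<lhd> G\<lparr>carrier := N\<rparr> \<and> card P = p ^ multiplicity p (order (G\<lparr>carrier := N\<rparr>))"
        using dN by (intro less.hyps[OF lt evolving_normal_subgroup[OF less.prems(1) N]] less.prems(2))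
          (auto simp: order_def intro: dvd_trans)
      then show ?thesis using that by (auto simp: order_def)
    qed
    have sP0: "subgroup P0 G" by (rule incl_subgroup[OF sN normal_imp_subgroup[OF P0(1)]])
    have P0G: "P0 \<subseteq> carrier G" by (rule subgroup.subset[OF sP0])
    have finP0: "finite P0" using P0G fin by (rule finite_subset)
    \<comment> \<open>All \<open>p\<close>-subgroups of \<open>G\<close> lie in \<open>N\<close>,
      hence in its normal Sylow subgroup \<open>P0\<close>. This yields both invariance of
      \<open>P0\<close> under conjugation by \<open>G\<close> and its having the full Sylow order in
      \<open>G\<close>.\<close>
    have max: "Q \<subseteq> P0" if Q: "subgroup Q G" "card Q = p ^ n" for Q n
      using N.p_subgroup_subset_normal_sylow[OF _ p P0(1) _ subgroup_incl[OF Q(1) sN pN[OF Q]] Q(2)]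
        finN P0(2) by (simp add: order_def)
    have "conj_by G x P0 = P0" if x: "x \<in> carrier G" for x
    proof (rule card_subset_eq[OF finP0])
      show "card (conj_by G x P0) = card P0" by (rule card_conj_by[OF x P0G])
      then show "conj_by G x P0 \<subseteq> P0"
        using max[OF subgroup_conj_by[OF x sP0]] P0(2) by simp
    qed
    then have nP0: "P0 \<lhd> G" by (rule normal_if_conj_by[OF sP0])
    obtain m' where m': "order G = p ^ multiplicity p (order G) * m'"
      using multiplicity_dvd[of p "order G"] by auto
    obtain P where P: "subgroup P G" "card P = p ^ multiplicity p (order G)"
      using sylow_thm[OF p G m' fin] by blast
    have "p ^ multiplicity p (order G) \<le> p ^ multiplicity p (card N)"
      using card_mono[OF finP0 max[OF P]] P(2) P0(2) by simp
    moreover have "multiplicity p (card N) \<le> multiplicity p (order G)"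
      using dN pos by (intro dvd_imp_multiplicity_le) auto
    then have "p ^ multiplicity p (card N) \<le> p ^ multiplicity p (order G)"
      using p by (metis power_increasing prime_ge_1_nat)
    ultimately show ?thesis using nP0 P0(2) by (intro exI[of _ P0]) simp
  qed
qed

section \<open>Conjugacy in the normal Sylow subgroup, and its complement\<close>

context group
begin

lemma evolving_normal_sylow_intense:
  assumes ev: "evolving G" and p: "prime p"
    and P: "P \<lhd> G" "card P = p ^ multiplicity p (order G)"
    and H: "subgroup H G" "H \<subseteq> P" and x: "x \<in> carrier G"
  shows "\<exists>y \<in> P. conj_by G x H = conj_by G y H"
proof -
  have fin: "finite (carrier G)" using ev by (simp add: evolving_def)
  have pos: "order G > 0" using fin by (simp add: order_gt_0_iff_finite)
  have sP: "subgroup P G" by (rule normal_imp_subgroup[OF P(1)])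
  have PG: "P \<subseteq> carrier G" and HG: "H \<subseteq> carrier G" using sP H by (auto dest: subgroup.subset)
  have "card H dvd p ^ multiplicity p (order G)" using card_subgroup_dvd[OF H(1) sP H(2)] P(2) by simp
  then obtain h where h: "card H = p ^ h" using p by (auto simp: divides_primepow_nat)
  obtain J k c where J: "subgroup J G" "H \<subseteq> J" "order G = card J * p ^ k" "card J = card H * c" "coprime c p"
    using evolvingD[OF ev p H(1) h] .
  have JG: "J \<subseteq> carrier G" by (rule subgroup.subset[OF J(1)])
  have PJ: "subgroup (P \<inter> J) G" by (rule subgroups_Inter_pair[OF sP J(1)])
  have "H \<subseteq> P \<inter> J" using H J by blast
  from card_subgroup_dvd[OF H(1) PJ this] obtain d where d: "card (P \<inter> J) = card H * d"
    by (rule dvdE)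
  have "card H * d dvd card H * c"
    using card_subgroup_dvd[OF PJ J(1)] d J(4) by simp
  \<comment> \<open>The index \<open>d\<close> of \<open>H\<close> in \<open>P \<inter> J\<close>
    divides both a power of \<open>p\<close> and the number \<open>c\<close> prime to
    \<open>p\<close>, so it is 1.\<close>
  then have "d dvd c" using h p by (simp add: prime_gt_0_nat)
  have "card H * d dvd p ^ multiplicity p (order G)"
    using card_subgroup_dvd[OF PJ sP] d P(2) by simp
  then have "d dvd p ^ multiplicity p (order G)" by (rule dvd_mult_right)
  then have "d = 1"
    using \<open>d dvd c\<close> J(5) by (metis coprime_common_divisor coprime_power_right_iff nat_dvd_1_iff_1 power_0 dvd_1_left)
  then have "card H = card (P \<inter> J)" using d by simp
  moreover have "finite (P \<inter> J)" using PG fin by (meson finite_Int finite_subset)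
  ultimately have HPJ: "H = P \<inter> J" using \<open>H \<subseteq> P \<inter> J\<close> by (simp add: card_subset_eq)
  have "\<not> p dvd c" using J pos p by (auto simp: prime_nat_iff coprime_absorb_right)
  have "order G = p ^ (h + k) * c" using J(3,4) h by (simp add: power_add)
  then have "multiplicity p (order G) = h + k"
    using multiplicity_power_times[OF p \<open>\<not> p dvd c\<close>] by simp
  \<comment> \<open>With \<open>H = P \<inter> J\<close> the product formula shows that
    \<open>P <#> J\<close> is all of \<open>G\<close>. Writing \<open>x\<close> as
    \<open>y \<otimes> j\<close> leaves only \<open>y\<close>, since \<open>j\<close> normalizes
    both \<open>P\<close> and \<open>J\<close> and therefore \<open>H\<close>.\<close>
  then have "card (P <#> J) * p ^ h = p ^ (h + k) * card J"
    using card_set_mult[OF sP J(1)] P(2) h HPJ by simp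
  also have "\<dots> = order G * p ^ h"
    unfolding J(3) power_add by (simp only: mult_ac)
  finally have "card (P <#> J) * p ^ h = order G * p ^ h" .
  then have "card (P <#> J) = card (carrier G)" using p by (auto simp: order_def)
  then have "P <#> J = carrier G"
    using setmult_subset_G[OF PG JG] fin by (simp add: card_subset_eq)
  then have "x \<in> P <#> J" using x by simp
  then obtain y j where y: "y \<in> P" "j \<in> J" "x = y \<otimes> j" by (auto simp: set_mult_def)
  have yj: "y \<in> carrier G" "j \<in> carrier G" using y PG JG by auto
  have "conj_by G j H = H"
  proof (rule card_subset_eq)
    show "finite H" using HG fin by (rule finite_subset)
    show "conj_by G j H \<subseteq> H"
      using conj_by_mono[of H P j] conj_by_mono[of H J j] normal_conj_by[OF P(1) yj(2)]
        conj_by_self[OF J(1) y(2)] HPJ by auto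
    show "card (conj_by G j H) = card H" by (rule card_conj_by[OF yj(2) HG])
  qed
  then have "conj_by G x H = conj_by G y H"
    using conj_by_mult[OF yj HG] y(3) by simp
  then show ?thesis using y(1) by blast
qed

text \<open>For the prime \<open>p\<close> only the trivial subgroup of \<open>K\<close> arises, and
  \<open>K\<close> itself serves. For \<open>r \<noteq> p\<close> the index |JP : J| divides powers
  of both \<open>r\<close> and \<open>p\<close>, so \<open>P\<close> lies in \<open>J\<close>. Hence
  KJ = G, and \<open>K \<inter> J\<close> has the same index in \<open>K\<close> as \<open>J\<close>
  in \<open>G\<close>.\<close>

lemma evolving_sylow_complement:
  assumes ev: "evolving G" and p: "prime p"
    and P: "P \<lhd> G" "card P = p ^ multiplicity p (order G)"
    and K: "subgroup K G" "order G = card K * p ^ k" "coprime (card K) p"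
  shows "evolving (G\<lparr>carrier := K\<rparr>)"
proof -
  have fin: "finite (carrier G)" using ev by (simp add: evolving_def)
  have sP: "subgroup P G" by (rule normal_imp_subgroup[OF P(1)])
  have PG: "P \<subseteq> carrier G" and KG: "K \<subseteq> carrier G" using sP K by (auto dest: subgroup.subset)
  have finK: "finite K" using KG fin by (rule finite_subset)
  interpret K: group "G\<lparr>carrier := K\<rparr>" by (rule subgroup_imp_group[OF K(1)])
  have cK: "card K > 0" by (rule subgroup.finite_imp_card_positive[OF K(1) fin])
  have "\<not> p dvd card K" using K(3) p by (auto simp: prime_nat_iff coprime_absorb_right)
  have "multiplicity p (order G) = k"
    using multiplicity_power_times[OF p \<open>\<not> p dvd card K\<close>] K(2) by (simp add: mult.commute)
  then have cP: "card P = p ^ k" using P(2) by simp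
  have "card (K \<inter> P) dvd card K" "card (K \<inter> P) dvd card P"
    by (intro card_subgroup_dvd subgroups_Inter_pair K sP; blast)+
  moreover have "coprime (card K) (card P)" using K(3) cP by simp
  ultimately have "card (K \<inter> P) = 1" by (metis coprime_common_divisor nat_dvd_1_iff_1)
  then have cKP: "card (K <#> P) = order G" using card_set_mult[OF K(1) sP] cP K(2) by simp
  have "\<exists>J k c. subgroup J (G\<lparr>carrier := K\<rparr>) \<and> I \<subseteq> J \<and> order (G\<lparr>carrier := K\<rparr>) = card J * r ^ k \<and>
      card J = card I * c \<and> coprime c r"
    if r: "prime r" and I: "subgroup I (G\<lparr>carrier := K\<rparr>)" "card I = r ^ n" for r I n
  proof -
    have IG: "subgroup I G" by (rule incl_subgroup[OF K(1) I(1)])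
    have IK: "I \<subseteq> K" using subgroup.subset[OF I(1)] by simp
    show ?thesis
    proof (cases "r = p")
      case True
      have "card I dvd card K" by (rule card_subgroup_dvd[OF IG K(1) IK])
      then have "card I = 1" using K(3) I(2) True
        by (metis coprime_common_divisor coprime_power_right_iff dvd_refl nat_dvd_1_iff_1 power_0)
      then show ?thesis
        using K.subgroup_self IK K(3) True
        by (intro exI[of _ K] exI[of _ 0] exI[of _ "card K"]) (simp add: order_def)
    next
      case False
      obtain J l c where J: "subgroup J G" "I \<subseteq> J" "order G = card J * r ^ l" "card J = card I * c" "coprime c r"
        using evolvingD[OF ev r IG I(2)] .
      have JG: "J \<subseteq> carrier G" by (rule subgroup.subset[OF J(1)])
      have cJ: "card J > 0" by (rule subgroup.finite_imp_card_positive[OF J(1) fin])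
      have "conj_by G x P = P" if "x \<in> J" for x
        using normal_conj_by[OF P(1)] that JG by auto
      then have JP: "subgroup (J <#> P) G" by (rule subgroup_set_mult[OF J(1) sP])
      obtain e where e: "card (J <#> P) = card J * e"
        using card_subgroup_dvd[OF J(1) JP set_mult_supset(1)[OF J(1) sP]] by auto
      have "card J * e dvd card J * r ^ l" using card_subgroup_dvd_order[OF JP] e J(3) by simp
      then have "e dvd r ^ l" using cJ by simp
      have "card J * (e * card (J \<inter> P)) = card J * card P"
        using card_set_mult[OF J(1) sP] e by (simp add: mult.assoc)
      then have "e * card (J \<inter> P) = p ^ k" using cJ cP by simp
      then have "e dvd p ^ k" by (metis dvd_triv_left)
      moreover have "coprime (r ^ l) (p ^ k)" using False r p by (simp add: primes_coprime)
      ultimately have "e = 1" using \<open>e dvd r ^ l\<close> by (metis coprime_common_divisor nat_dvd_1_iff_1)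
      then have "card J = card (J <#> P)" using e by simp
      moreover have "finite (J <#> P)" using subgroup.subset[OF JP] fin by (rule finite_subset)
      ultimately have "J = J <#> P"
        using set_mult_supset(1)[OF J(1) sP] by (simp add: card_subset_eq)
      then have PJ: "P \<subseteq> J" using set_mult_supset(2)[OF J(1) sP] by simp
      have KJG: "K <#> J \<subseteq> carrier G" by (rule setmult_subset_G[OF KG JG])
      have "order G \<le> card (K <#> J)"
        unfolding cKP[symmetric] using KJG fin by (intro card_mono mono_set_mult PJ) (auto intro: finite_subset)
      moreover have "card (K <#> J) \<le> order G"
        unfolding order_def using fin KJG by (rule card_mono)
      ultimately have "card J * r ^ l * card (K \<inter> J) = card K * card J"
        using card_set_mult[OF K(1) J(1)] J(3) by simp
      then have oK: "order (G\<lparr>carrier := K\<rparr>) = card (K \<inter> J) * r ^ l"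
        using cJ by (simp add: order_def mult.commute)
      have KJ: "subgroup (K \<inter> J) G" by (rule subgroups_Inter_pair[OF K(1) J(1)])
      have IKJ: "I \<subseteq> K \<inter> J" using IK J(2) by blast
      obtain c1 where c1: "card (K \<inter> J) = card I * c1"
        using card_subgroup_dvd[OF IG KJ IKJ] by auto
      obtain c2 where c2: "card J = card (K \<inter> J) * c2"
        using card_subgroup_dvd[OF KJ J(1)] by auto
      have "card I > 0" using I(2) r by (simp add: prime_gt_0_nat)
      moreover have "card I * (c1 * c2) = card I * c" using J(4) c1 c2 by (simp add: mult.assoc)
      ultimately have "c1 * c2 = c" by simp
      then have "coprime c1 r" using J(5) by auto
      then show ?thesis using subgroup_incl[OF KJ K(1)] IKJ oK c1 by blast
    qed
  qed
  then show ?thesis using K.evolving_iff finK by auto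
qed

end

subsection \<open>The equivalence\<close>

lemma evolving_imp_prime_intense:
  fixes G :: "('a, 'b) monoid_scheme"
  assumes "evolving G"
  shows "prime_intense G"
  using assms
proof (induction "order G" arbitrary: G rule: less_induct)
  case less
  then have G: "group G" and fin: "finite (carrier G)" by (auto simp: evolving_def)
  interpret group G by (rule G)
  have pos: "order G > 0" using fin by (simp add: order_gt_0_iff_finite)
  show ?case
  proof (cases "\<exists>q. prime q \<and> q dvd order G")
    case False
    then show ?thesis using G fin by (auto simp: prime_intense_def)
  next
    case True
    then have ne: "prime_factors (order G) \<noteq> {}" using prime_factorsI[of "order G"] pos by blast
    define p where "p = Max (prime_factors (order G))"
    have "p \<in> prime_factors (order G)" unfolding p_def using ne by (intro Max_in) auto
    then have p: "prime p" "p dvd order G" by (auto simp: in_prime_factors_iff)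
    have le: "q \<le> p" if "prime q" "q dvd order G" for q
      unfolding p_def using that pos by (intro Max_ge prime_factorsI) auto
    obtain P where P: "P \<lhd> G" "card P = p ^ multiplicity p (order G)"
      using evolving_normal_sylow[OF less.prems p(1) le] by blast
    have sP: "subgroup P G" by (rule normal_imp_subgroup[OF P(1)])
    \<comment> \<open>Evolving the trivial \<open>p\<close>-subgroup produces a subgroup of order
      prime to \<open>p\<close> and of \<open>p\<close>-power index, that is, a complement
      \<open>K\<close> of \<open>P\<close>.\<close>
    have "card {\<one>\<^bsub>G\<^esub>} = p ^ 0" by simp
    then obtain K k c where "subgroup K G" "{\<one>\<^bsub>G\<^esub>} \<subseteq> K" "order G = card K * p ^ k"
        "card K = card {\<one>\<^bsub>G\<^esub>} * c" "coprime c p"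
      by (rule evolvingD[OF less.prems p(1) triv_subgroup])
    then have K: "subgroup K G" "order G = card K * p ^ k" "coprime (card K) p" by simp_all
    have KG: "K \<subseteq> carrier G" by (rule subgroup.subset[OF K(1)])
    have evK: "evolving (G\<lparr>carrier := K\<rparr>)"
      using evolving_sylow_complement[OF less.prems p(1) P K] .
    have "\<not> p dvd card K" using K p(1) by (auto simp: prime_nat_iff coprime_absorb_right)
    then have "k \<noteq> 0" using p(2) K(2) by (cases k) auto
    then have "p ^ k > 1" using p(1) by (metis bot_nat_0.not_eq_extremum one_less_power prime_gt_1_nat)
    moreover have "card K > 0" by (rule subgroup.finite_imp_card_positive[OF K(1) fin])
    ultimately have "order (G\<lparr>carrier := K\<rparr>) < order G" using K(2) by (simp add: order_def)
    then have "prime_intense (G\<lparr>carrier := K\<rparr>)" using less.hyps evK by blast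
    moreover have oK: "order (G\<lparr>carrier := K\<rparr>) = card K" by (simp add: order_def)
    ultimately obtain S where Syl: "\<And>q. prime q \<Longrightarrow> q dvd card K \<Longrightarrow> S q \<in> Syl q (G\<lparr>carrier := K\<rparr>)"
      and int: "\<And>r q. prime r \<Longrightarrow> prime q \<Longrightarrow> r dvd card K \<Longrightarrow> q dvd card K \<Longrightarrow> q < r \<Longrightarrow>
        S q \<subseteq> normalizer (G\<lparr>carrier := K\<rparr>) (S r) \<and>
        (\<forall>H x. subgroup H (G\<lparr>carrier := K\<rparr>) \<longrightarrow> H \<subseteq> S r \<longrightarrow> x \<in> S q \<longrightarrow>
          (\<exists>y \<in> S r. conj_by (G\<lparr>carrier := K\<rparr>) x H = conj_by (G\<lparr>carrier := K\<rparr>) y H))"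
      unfolding prime_intense_def oK by blast
    have dK: "q dvd card K" if "prime q" "q dvd order G" "q \<noteq> p" for q
      using that p(1) K(2) by (metis prime_dvd_mult_iff prime_dvd_power primes_dvd_imp_eq)
    have SK: "subgroup (S q) G" "S q \<subseteq> K" "card (S q) = q ^ multiplicity q (card K)" if "prime q" "q dvd card K" for q
    proof -
      have s: "subgroup (S q) (G\<lparr>carrier := K\<rparr>)" using Syl[OF that] by (simp add: Syl_def)
      show "subgroup (S q) G" by (rule incl_subgroup[OF K(1) s])
      show "S q \<subseteq> K" using subgroup.subset[OF s] by simp
      show "card (S q) = q ^ multiplicity q (card K)" using Syl[OF that] by (simp add: Syl_def order_def)
    qed
    interpret K: group "G\<lparr>carrier := K\<rparr>" by (rule subgroup_imp_group[OF K(1)])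
    define T where "T = S(p := P)"
    show ?thesis
      unfolding prime_intense_def
    proof (intro conjI G fin exI[of _ T] allI impI)
      fix q assume q: "prime q" "q dvd order G"
      show "T q \<in> Syl q G"
      proof (cases "q = p")
        case True
        then show ?thesis using sP P(2) by (simp add: T_def Syl_def)
      next
        case False
        \<comment> \<open>The index of \<open>K\<close> is a power of \<open>p\<close>, so for the
          other primes a Sylow subgroup of \<open>K\<close> is already one of
          \<open>G\<close>.\<close>
        have "multiplicity q (order G) = multiplicity q (card K)"
          using q(1) p(1) False K(2) \<open>card K > 0\<close>
          by (simp add: prime_elem_multiplicity_mult_distrib multiplicity_distinct_prime_power)
        then show ?thesis using False SK[OF q(1) dK[OF q False]] by (simp add: T_def Syl_def)
      qed
    next
      fix r q assume r: "prime r" "r dvd order G" and q: "prime q" "q dvd order G" and "q < r"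
      \<comment> \<open>As \<open>p\<close> is the largest prime, only \<open>r\<close> can equal
        it. That case rests on normality of \<open>P\<close>; all other pairs come from
        \<open>K\<close>.\<close>
      have "q \<noteq> p" using le[OF r] \<open>q < r\<close> by auto
      note qK = dK[OF q this]
      have Tq: "T q = S q" using \<open>q \<noteq> p\<close> by (simp add: T_def)
      have TqG: "T q \<subseteq> carrier G" using Tq SK(2)[OF q(1) qK] KG by auto
      show "T q \<subseteq> normalizer G (T r)"
      proof (cases "r = p")
        case True
        then show ?thesis
          using TqG normal_conj_by[OF P(1)] subgroup.subset[OF sP] by (auto simp: T_def normalizer_iff)
      next
        case False
        note rK = dK[OF r False]
        have Tr: "T r = S r" using False by (simp add: T_def)
        have "x \<in> normalizer G (S r)" if x: "x \<in> S q" for x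
        proof -
          have "x \<in> normalizer (G\<lparr>carrier := K\<rparr>) (S r)" using int[OF r(1) q(1) rK qK \<open>q < r\<close>] x by blast
          then have "x \<in> K" "conj_by G x (S r) = S r"
            using K.normalizer_iff[of "S r" x] SK(2)[OF r(1) rK] conj_by_update[OF K(1)] by auto
          then show ?thesis using KG SK(2)[OF r(1) rK] by (subst normalizer_iff) auto
        qed
        then show ?thesis using Tq Tr by auto
      qed
      fix H x assume H: "subgroup H G" "H \<subseteq> T r" and x: "x \<in> T q"
      show "\<exists>y \<in> T r. conj_by G x H = conj_by G y H"
      proof (cases "r = p")
        case True
        then show ?thesis
          using evolving_normal_sylow_intense[OF less.prems p(1) P H(1), of x] H(2) x TqG by (auto simp: T_def)
      next
        case False
        note rK = dK[OF r False]
        have Tr: "T r = S r" using False by (simp add: T_def)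
        have HK: "H \<subseteq> K" using H(2) Tr SK(2)[OF r(1) rK] by blast
        have "\<exists>y \<in> S r. conj_by (G\<lparr>carrier := K\<rparr>) x H = conj_by (G\<lparr>carrier := K\<rparr>) y H"
          using int[OF r(1) q(1) rK qK \<open>q < r\<close>] subgroup_incl[OF H(1) K(1) HK] H(2) x Tr Tq by simp
        then show ?thesis
          using Tr Tq x SK(2)[OF r(1) rK] SK(2)[OF q(1) qK] conj_by_update[OF K(1)] by (metis subsetD)
      qed
    qed
  qed
qed

lemma prime_intense_imp_evolving:
  fixes G :: "('a, 'b) monoid_scheme" (structure)
  assumes "prime_intense G"
  shows "evolving G"
proof -
  have G: "group G" and fin: "finite (carrier G)" using assms by (auto simp: prime_intense_def)
  interpret group G by (rule G)
  have pos: "order G > 0" using fin by (simp add: order_gt_0_iff_finite)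
  let ?F = "prime_factors (order G)"
  obtain S where Syl: "\<And>q. prime q \<Longrightarrow> q dvd order G \<Longrightarrow> S q \<in> Syl q G"
    and int: "\<And>p q. prime p \<Longrightarrow> prime q \<Longrightarrow> p dvd order G \<Longrightarrow> q dvd order G \<Longrightarrow> q < p \<Longrightarrow>
      S q \<subseteq> normalizer G (S p) \<and>
      (\<forall>H x. subgroup H G \<longrightarrow> H \<subseteq> S p \<longrightarrow> x \<in> S q \<longrightarrow> (\<exists>y \<in> S p. conj_by G x H = conj_by G y H))"
    using assms unfolding prime_intense_def by blast
  have F: "prime q \<and> q dvd order G" if "q \<in> ?F" for q using that by (auto simp: in_prime_factors_iff)
  have S: "subgroup (S q) G" "card (S q) = q ^ multiplicity q (order G)" if "q \<in> ?F" for q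
    using Syl F[OF that] by (auto simp: Syl_def)
  have nrm: "conj_by G x (S r) = S r" if "q \<in> ?F" "r \<in> ?F" "q < r" "x \<in> S q" for q r x
    using int[of r q] F that normalizer_iff[OF subgroup.subset[OF S(1)[OF that(2)]]] by blast
  have "\<exists>J k c. subgroup J G \<and> I \<subseteq> J \<and> order G = card J * p ^ k \<and> card J = card I * c \<and> coprime c p"
    if p: "prime p" and I: "subgroup I G" "card I = p ^ n" for p I n
  proof (cases "p dvd order G")
    case False
    then have cop: "coprime (order G) p" using p by (metis coprime_commute prime_imp_coprime)
    have "card I dvd order G" by (rule card_subgroup_dvd_order[OF I(1)])
    then have "card I = 1" using cop I(2)
      by (metis coprime_common_divisor coprime_power_right_iff dvd_refl nat_dvd_1_iff_1 power_0)
    then show ?thesis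
      using subgroup_self subgroup.subset[OF I(1)] cop
      by (intro exI[of _ "carrier G"] exI[of _ 0] exI[of _ "order G"]) (simp add: order_def)
  next
    case True
    have pF: "p \<in> ?F" using p True pos by (simp add: in_prime_factors_iff)
    let ?a = "multiplicity p (order G)"
    have PG: "S p \<subseteq> carrier G" by (rule subgroup.subset[OF S(1)[OF pF]])
    have IG: "I \<subseteq> carrier G" by (rule subgroup.subset[OF I(1)])
    obtain g where g: "g \<in> carrier G" "I \<subseteq> conj_by G g (S p)"
      using sylow_contains_conj[OF fin p S[OF pF] I] by blast
    \<comment> \<open>The given subgroup is first moved into \<open>S p\<close>, where the intensity
      condition applies, and later inside \<open>S p\<close> to \<open>H\<close>, which the Sylow
      subgroups for smaller primes normalize.\<close>
    define I' where "I' = conj_by G (inv g) I"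
    have I': "subgroup I' G" unfolding I'_def using g by (intro subgroup_conj_by I) auto
    have I'P: "I' \<subseteq> S p" using conj_by_mono[OF g(2), of "inv g"] g(1) PG by (simp add: I'_def conj_by_inv_cancel)
    have cI': "card I' = p ^ n" using I(2) g(1) IG by (simp add: I'_def card_conj_by)
    let ?E = "{q \<in> ?F. q < p}"
    have int': "\<exists>y \<in> S p. conj_by G x H = conj_by G y H"
      if "q \<in> ?E" "x \<in> S q" "subgroup H G" "H \<subseteq> S p" for q x H
    proof -
      have "q \<in> ?F" "q < p" using that(1) by auto
      then show ?thesis using int[OF p _ True, of q] F[of q] that(2-4) by blast
    qed
    have "\<exists>H. (\<exists>s \<in> S p. H = conj_by G s I') \<and> (\<forall>q \<in> ?E. \<forall>x \<in> S q. conj_by G x H = H)"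
    proof -
      have "{H. (\<exists>s \<in> S p. H = conj_by G s I') \<and> (\<forall>q \<in> ?E. \<forall>x \<in> S q. conj_by G x H = H)} \<noteq> {}"
        by (rule intense_tower_fixed_conj[THEN conjunct1, OF fin p S[OF pF] I' I'P])
           (use F S nrm pF int' in \<open>auto\<close>)
      then show ?thesis by blast
    qed
    then obtain s where s: "s \<in> S p" and sfix: "\<And>q x. q \<in> ?E \<Longrightarrow> x \<in> S q \<Longrightarrow> conj_by G x (conj_by G s I') = conj_by G s I'"
      by blast
    have sG: "s \<in> carrier G" using s PG by auto
    define H where "H = conj_by G s I'"
    have H: "subgroup H G" unfolding H_def by (rule subgroup_conj_by[OF sG I'])
    have HP: "H \<subseteq> S p" unfolding H_def using conj_by_mono[OF I'P, of s] conj_by_self[OF S(1)[OF pF] s] by simp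
    have cH: "card H = p ^ n" unfolding H_def using cI' sG subgroup.subset[OF I'] by (simp add: card_conj_by)
    \<comment> \<open>Replacing \<open>S p\<close> by \<open>H\<close> keeps the tower intact: as a
      subset of \<open>S p\<close> it normalizes the members for larger primes, and by the choice of
      \<open>s\<close> it is normalized by those for smaller primes.\<close>
    define A where "A = S(p := H)"
    have "\<exists>J. subgroup J G \<and> (\<forall>q \<in> ?F. A q \<subseteq> J) \<and> card J = (\<Prod>q \<in> ?F. card (A q)) \<and>
      (\<forall>x \<in> carrier G. (\<forall>q \<in> ?F. conj_by G x (A q) = A q) \<longrightarrow> conj_by G x J = J)"
    proof (rule tower_product[OF fin])
      show "prime q \<and> subgroup (A q) G \<and> (\<exists>e. card (A q) = q ^ e)" if "q \<in> ?F" for q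
        using F[OF that] S[OF that] H cH by (auto simp: A_def)
      show "conj_by G x (A r) = A r" if "q \<in> ?F" "r \<in> ?F" "q < r" "x \<in> A q" for q r x
        using that nrm[of q r x] sfix[of q x] HP by (auto simp: A_def H_def split: if_splits)
    qed simp
    then obtain J where J: "subgroup J G" "\<And>q. q \<in> ?F \<Longrightarrow> A q \<subseteq> J" "card J = (\<Prod>q \<in> ?F. card (A q))" by blast
    define c where "c = (\<Prod>q \<in> ?F - {p}. card (S q))"
    have cJ: "card J = p ^ n * c"
    proof -
      have "card J = card (A p) * (\<Prod>q \<in> ?F - {p}. card (A q))"
        unfolding J(3) using pF by (intro prod.remove) auto
      also have "(\<Prod>q \<in> ?F - {p}. card (A q)) = c" unfolding c_def by (rule prod.cong) (auto simp: A_def)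
      finally show ?thesis using cH by (simp add: A_def)
    qed
    have oG: "order G = p ^ ?a * c"
    proof -
      have "order G = (\<Prod>q \<in> ?F. card (S q))" using prod_prime_factors[of "order G"] pos S(2) by simp
      also have "\<dots> = card (S p) * c" unfolding c_def using pF by (intro prod.remove) auto
      finally show ?thesis using S(2)[OF pF] by simp
    qed
    have cop: "coprime c p"
      unfolding c_def
    proof (rule prod_coprime_left)
      fix q assume "q \<in> ?F - {p}"
      then show "coprime (card (S q)) p" using F[of q] S(2)[of q] p by (auto simp: primes_coprime)
    qed
    have "p ^ n dvd p ^ ?a"
      using card_subgroup_dvd[OF H S(1)[OF pF] HP] cH S(2)[OF pF] by simp
    then have "n \<le> ?a" using p by (simp add: dvd_power_iff_le prime_ge_2_nat)
    then have "p ^ ?a = p ^ n * p ^ (?a - n)" by (simp flip: power_add)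
    then have oJ: "order G = card J * p ^ (?a - n)" using oG cJ by (metis mult.assoc mult.commute)
    \<comment> \<open>This element undoes both moves, taking \<open>H\<close> back to
      \<open>I\<close> and thus \<open>J\<close> to a subgroup containing \<open>I\<close>.\<close>
    let ?t = "g \<otimes> inv s"
    have t: "?t \<in> carrier G" using g sG by simp
    have "conj_by G ?t H = conj_by G g (conj_by G (inv s) H)"
      using g sG subgroup.subset[OF H] by (simp add: conj_by_mult)
    also have "\<dots> = I" using g sG subgroup.subset[OF I'] IG by (simp add: H_def conj_by_inv_cancel) (simp add: I'_def conj_by_inv_cancel)
    finally have "I \<subseteq> conj_by G ?t J"
      using conj_by_mono[OF J(2)[OF pF], of ?t] by (simp add: A_def)
    moreover have "card (conj_by G ?t J) = card J" by (rule card_conj_by[OF t subgroup.subset[OF J(1)]])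
    ultimately show ?thesis
      using subgroup_conj_by[OF t J(1)] oJ cJ I(2) cop
      by (intro exI[of _ "conj_by G ?t J"] exI[of _ "?a - n"] exI[of _ c]) simp
  qed
  then show ?thesis using evolving_iff[OF fin] by blast
qed

theorem theorem2:
  fixes G :: "('a, 'b) monoid_scheme"
  assumes "group G" and "finite (carrier G)"
  shows "evolving G \<longleftrightarrow> prime_intense G"
  using evolving_imp_prime_intense prime_intense_imp_evolving by blast

end
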